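(* Assume $\delta_1\ge\delta_2$ and $t>0$. Consider the formula $$\dim_HM_c(t)=\max\Big\{\delta_1+\frac{\delta_2\log b}{t+\log b},\ \delta_2+\frac{\delta_1\log a}{t+\log a}\Big\}.\qquad(\ast)$$ Then $(\ast)$ holds in each of the following cases: (1) $a\le b$; (2) $a>b$ and $\log a\le t+\log b$; (3) $a>b$, $\log a>t+\log b$ and $\delta_2(t+\log a)\ge\delta_1\log a$. In the remaining case $a>b$, $\log a>t+\log b$ and $\delta_2(t+\log a)<\delta_1\log a$, formula $(\ast)$ fails.
   Context: Let $a,b\ge3$ be integers, $\Lambda_a\subset\{0,\dots,a-1\}$, $\Lambda_b\subset\{0,\dots,b-1\}$ with at least two elements each, $\mathcal C_a$ (resp. $\mathcal C_b$) the attractor of $\{x\mapsto(x+k)/a:k\in\Lambda_a\}$ (resp. with $b,\Lambda_b$), and $\delta_1=\log\#\Lambda_a/\log a$, $\delta_2=\log\#\Lambda_b/\log b$. Fix $(x_o,y_o)\in\mathcal C_a\times\mathcal C_b$; $\|\cdot\|$ is the distance to the nearest integer. $M_c(t)=\{(x,y)\in\mathcal C_a\times\mathcal C_b:\|a^nx-x_o\|\cdot\|b^ny-y_o\|<e^{-nt}\text{ for infinitely many }n\in\mathbb N\}$. *)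

theory Defs
  imports "HOL-Analysis.Analysis"
begin

definition attractor :: "nat \<Rightarrow> nat set \<Rightarrow> real set" where
  "attractor a \<Lambda> = (THE K. compact K \<and> K \<noteq> {} \<and>
      K = (\<Union>k\<in>\<Lambda>. (\<lambda>x. (x + real k) / real a) ` K))"

definition dist_int :: "real \<Rightarrow> real" where
  "dist_int x = min (frac x) (1 - frac x)"

definition Mc :: "nat \<Rightarrow> nat set \<Rightarrow> nat \<Rightarrow> nat set \<Rightarrow> real \<Rightarrow> real \<Rightarrow> real \<Rightarrow> (real \<times> real) set" where
  "Mc a \<Lambda>a b \<Lambda>b xo yo t = {(x, y). x \<in> attractor a \<Lambda>a \<and> y \<in> attractor b \<Lambda>b \<and>
      infinite {n::nat. dist_int (real a ^ n * x - xo) * dist_int (real b ^ n * y - yo)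
                         < exp (- real n * t)}}"

definition hausdorff_approx :: "real \<Rightarrow> real \<Rightarrow> 'a::metric_space set \<Rightarrow> ennreal" where
  "hausdorff_approx s d E = (INF U \<in> {U :: nat \<Rightarrow> 'a set. E \<subseteq> (\<Union>i. U i) \<and>
        (\<forall>i. bounded (U i) \<and> diameter (U i) \<le> d)}.
        (\<Sum>i. ennreal (diameter (U i) powr s)))"

definition hausdorff_measure :: "real \<Rightarrow> 'a::metric_space set \<Rightarrow> ennreal" where
  "hausdorff_measure s E = (SUP d \<in> {0<..}. hausdorff_approx s d E)"

definition hausdorff_dim :: "'a::metric_space set \<Rightarrow> real" where
  "hausdorff_dim E = Inf {s. 0 \<le> s \<and> hausdorff_measure s E = 0}"

end

(* Write La = ln a, Lb = ln b, and d1, d2 for the similarity dimensions.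

   Upper bound: if ||a^n x - xo|| ||b^n y - yo|| < exp (-n t), then the two factors are at most
   exp (-n U) and exp (-n V) for one of finitely many pairs (U, V) with U + V close to t. Covering
   the points of such a pair by squares of side exp (-n max (La + U) (Lb + V)), i.e. of the shorter
   side of the rectangles that they form, gives the dimension
   d1 + d2 - (d1 U + d2 V) / max (La + U) (Lb + V), and outside the exceptional case this is
   largest at U = 0 or at V = 0.

   Lower bound: fix U + V = t. Force the digits of x after position G^k to agree with those of xo
   up to precision exp (-G^k U), force those of y likewise with V, and leave all other digits free.
   The uniform measure on such pairs (x, y) lives on the set, and the mass distribution principle
   bounds the dimension below by d1 + d2 minus the largest relative loss
   (d1 min U (r - La)^+ + d2 min V (r - Lb)^+) / r over the scales exp (-r G^k), up to an error
   that vanishes as G grows. U = 0 and V = 0 give the two terms of the formula; in the exceptional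
   case the squares used for the upper bound are no longer optimal, and an interior U does better
   than both. *)
theory Submission
  imports Defs "HOL-Probability.Probability"
begin

section \<open>Hausdorff measure\<close>

text \<open>The two bases need not be related, so there is no common grid: in both halves the digits
  of x and of y are cut off separately at the lengths matching one real scale, and rounding costs
  only constant factors. In units of n, the forced digits of x fill the relative scales from
  \<open>La\<close> to \<open>La + U\<close>, those of y the scales from \<open>Lb\<close> to
  \<open>Lb + V\<close>. A single window loses most, relative to the scale, exactly where it ends;
  hence the quotients t / (t + Lb) and t / (t + La). If \<open>La > t + Lb\<close>, every y window
  is over before the x window opens, so the loss peaks at two separate scales; under the second
  inequality of the exceptional case, some interior split of t keeps both peaks below the losses at
  U = 0 and V = 0. Two features of the definitions also shape the proof. \<open>attractor\<close> is
  a definite description, so uniqueness of the self-similar compact set has to come before any use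
  of digits. And \<open>0 powr 0 = 0\<close>, so sets of diameter zero cost nothing even for
  exponent 0 and must be null for the measures constructed.\<close>

lemma hausdorff_approx_le_double_sum:
  fixes V :: "nat \<Rightarrow> nat \<Rightarrow> 'a::metric_space set"
  assumes cover: "E \<subseteq> (\<Union>n. \<Union>j. V n j)"
    and V: "\<And>n j. bounded (V n j)" "\<And>n j. diameter (V n j) \<le> d"
  shows "hausdorff_approx s d E \<le> (\<Sum>n. \<Sum>j. ennreal (diameter (V n j) powr s))"
proof -
  define U where "U i = (case prod_decode i of (n, j) \<Rightarrow> V n j)" for i
  have "E \<subseteq> (\<Union>i. U i)"
  proof
    fix x assume "x \<in> E"
    then obtain n j where "x \<in> V n j" using cover by blast
    then have "x \<in> U (prod_encode (n, j))" by (simp add: U_def)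
    then show "x \<in> (\<Union>i. U i)" by blast
  qed
  moreover have "\<forall>i. bounded (U i) \<and> diameter (U i) \<le> d"
    using V by (auto simp: U_def split: prod.split)
  ultimately have "hausdorff_approx s d E \<le> (\<Sum>i. ennreal (diameter (U i) powr s))"
    unfolding hausdorff_approx_def by (intro INF_lower) auto
  also have "\<dots> = (\<Sum>i. (\<lambda>(n, j). ennreal (diameter (V n j) powr s)) (prod_decode i))"
    by (simp add: U_def case_prod_beta)
  also have "\<dots> = (\<Sum>n. \<Sum>j. ennreal (diameter (V n j) powr s))"
    by (rule suminf_ennreal_2dimen) simp
  finally show ?thesis .
qed

text \<open>Convergence half of Borel-Cantelli: every point of \<open>E\<close> lies in infinitely
  many of the unions, so each tail of the families covers \<open>E\<close>, and the tails of the
  cost series \<open>c\<close> are arbitrarily small.\<close>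

lemma hausdorff_measure_limsup_eq_0:
  fixes \<U> :: "nat \<Rightarrow> 'a::metric_space set set" and c e :: "nat \<Rightarrow> real"
  assumes fin: "\<And>n. finite (\<U> n)"
    and bdd: "\<And>n U. U \<in> \<U> n \<Longrightarrow> bounded U"
    and diam: "\<And>n U. U \<in> \<U> n \<Longrightarrow> diameter U \<le> e n" and e: "e \<longlonglongrightarrow> 0"
    and c: "\<And>n. (\<Sum>U\<in>\<U> n. diameter U powr s) \<le> c n" "summable c"
    and E: "\<And>x. x \<in> E \<Longrightarrow> infinite {n. x \<in> \<Union>(\<U> n)}"
  shows "hausdorff_measure s E = 0"
proof -
  have *: "hausdorff_approx s d E \<le> 0 + ennreal r" if "d > 0" "r > 0" for d r :: real
  proof -
    have c0: "c n \<ge> 0" for n using c(1)[of n] by (meson order_trans powr_ge_zero sum_nonneg)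
    obtain N1 where N1: "\<And>n. n \<ge> N1 \<Longrightarrow> e n \<le> d"
      using order_tendstoD(2)[OF e \<open>d > 0\<close>] unfolding eventually_sequentially by (meson less_imp_le)
    obtain N2 where N2: "\<And>n. n \<ge> N2 \<Longrightarrow> norm (\<Sum>i. c (i + n)) < r"
      using suminf_exist_split[OF \<open>r > 0\<close> c(2)] by blast
    define N where "N = max N1 N2"
    have "\<exists>h. bij_betw h {0..<card (\<U> n)} (\<U> n)" for n
      using ex_bij_betw_nat_finite[OF fin] .
    then obtain h where h: "\<And>n. bij_betw (h n) {0..<card (\<U> n)} (\<U> n)" by metis
    \<comment> \<open>Finite families are padded with empty sets to full sequences; the padding is
      free because \<open>0 powr s = 0\<close>, even for \<open>s = 0\<close>.\<close>
    define V where "V n j = (if j < card (\<U> (n + N)) then h (n + N) j else {})" for n j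
    have hin: "h n j \<in> \<U> n" if "j < card (\<U> n)" for n j
      using h[of n] that by (auto simp: bij_betw_def)
    have "hausdorff_approx s d E \<le> (\<Sum>n. \<Sum>j. ennreal (diameter (V n j) powr s))"
    proof (rule hausdorff_approx_le_double_sum)
      show "E \<subseteq> (\<Union>n. \<Union>j. V n j)"
      proof
        fix x assume "x \<in> E"
        from E[OF this] obtain n where n: "n \<ge> N" "x \<in> \<Union>(\<U> n)"
          unfolding infinite_nat_iff_unbounded_le by blast
        then obtain U where U: "U \<in> \<U> n" "x \<in> U" by blast
        then obtain j where j: "j < card (\<U> n)" "h n j = U"
          using bij_betw_imp_surj_on[OF h[of n]] by (metis atLeastLessThan_iff imageE)
        then have "V (n - N) j = U" using n by (simp add: V_def)
        then show "x \<in> (\<Union>n. \<Union>j. V n j)" using U by blast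
      qed
      show "bounded (V n j)" for n j using bdd hin by (auto simp: V_def)
      show "diameter (V n j) \<le> d" for n j
        using order_trans[OF diam[OF hin] N1[of "n + N"]] \<open>d > 0\<close> by (auto simp: V_def N_def)
    qed
    also have "\<dots> \<le> (\<Sum>n. ennreal (c (n + N)))"
    proof (intro suminf_le allI summableI)
      fix n
      have "(\<Sum>j. ennreal (diameter (V n j) powr s))
          = (\<Sum>j\<in>{0..<card (\<U> (n + N))}. ennreal (diameter (V n j) powr s))"
        by (rule suminf_finite) (auto simp: V_def)
      also have "\<dots> = (\<Sum>j\<in>{0..<card (\<U> (n + N))}. ennreal (diameter (h (n + N) j) powr s))"
        by (rule sum.cong) (auto simp: V_def)
      also have "\<dots> = (\<Sum>U\<in>\<U> (n + N). ennreal (diameter U powr s))"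
        by (rule sum.reindex_bij_betw[OF h])
      also have "\<dots> = ennreal (\<Sum>U\<in>\<U> (n + N). diameter U powr s)"
        by (simp add: sum_ennreal)
      also have "\<dots> \<le> ennreal (c (n + N))" using c(1) by (rule ennreal_leI)
      finally show "(\<Sum>j. ennreal (diameter (V n j) powr s)) \<le> ennreal (c (n + N))" .
    qed
    also have "\<dots> = ennreal (\<Sum>n. c (n + N))"
      using c0 summable_ignore_initial_segment[OF c(2)] by (intro suminf_ennreal2) auto
    also have "\<dots> \<le> ennreal r"
      using N2[of N] by (intro ennreal_leI) (simp add: N_def)
    finally show ?thesis by simp
  qed
  have "hausdorff_approx s d E \<le> 0" if "d > 0" for d
    by (rule ennreal_le_epsilon, rule *[OF that], assumption)
  then have "hausdorff_measure s E \<le> 0"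
    unfolding hausdorff_measure_def by (intro SUP_least) auto
  then show ?thesis by simp
qed

text \<open>A cover of \<open>E\<close> pulls back to a cover of the whole probability space, so its
  cost is at least \<open>1 / C\<close>. Covering sets are arbitrary and \<open>f\<close> carries no
  measurability assumption, whence the measurable supersets \<open>A\<close>. Covers of mesh 1
  suffice, since \<open>hausdorff_measure\<close> is a supremum over meshes.\<close>

lemma mass_distribution_principle:
  fixes f :: "'b \<Rightarrow> 'a::metric_space"
  assumes P: "prob_space P" and f: "\<And>\<omega>. \<omega> \<in> space P \<Longrightarrow> f \<omega> \<in> E"
    and "s' > 0" "C > 0"
    and A: "\<And>U r. \<lbrakk>bounded U; diameter U \<le> r; 0 < r; r \<le> 1\<rbrakk> \<Longrightarrow>
      \<exists>A\<in>sets P. {\<omega>\<in>space P. f \<omega> \<in> U} \<subseteq> A \<and> emeasure P A \<le> ennreal (C * r powr s')"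
    and s: "0 \<le> s" "s \<le> s'"
  shows "hausdorff_measure s E \<noteq> 0"
proof
  interpret prob_space P by fact
  have A': "\<exists>A\<in>sets P. {\<omega>\<in>space P. f \<omega> \<in> U} \<subseteq> A \<and> emeasure P A \<le> ennreal (C * diameter U powr s)"
    if U: "bounded U" "diameter U \<le> 1" for U
  proof (cases "diameter U = 0")
    case False
    then have d: "diameter U > 0" using diameter_ge_0[OF U(1)] by simp
    then have "diameter U powr s' \<le> diameter U powr s"
      using U s by (simp add: powr_mono')
    then have "ennreal (C * diameter U powr s') \<le> ennreal (C * diameter U powr s)"
      using \<open>C > 0\<close> by (intro ennreal_leI mult_left_mono) auto
    then show ?thesis using A[OF U(1) order_refl d U(2)] by (meson order_trans)
  next
    \<comment> \<open>For diameter zero the required bound is 0, so the preimage is enclosed in the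
      intersection of the events obtained for the radii \<open>1 / Suc k\<close>.\<close>
    case True
    have "\<exists>A\<in>sets P. {\<omega>\<in>space P. f \<omega> \<in> U} \<subseteq> A \<and> emeasure P A \<le> ennreal (C * (1 / Suc k) powr s')" for k
      using True by (intro A U) auto
    then obtain B where B: "\<And>k. B k \<in> sets P" "\<And>k. {\<omega>\<in>space P. f \<omega> \<in> U} \<subseteq> B k"
      "\<And>k. emeasure P (B k) \<le> ennreal (C * (1 / Suc k) powr s')" by metis
    have le: "emeasure P (\<Inter>k. B k) \<le> ennreal (C * (1 / Suc k) powr s')" for k
      using B(3)[of k] emeasure_mono[of "\<Inter>k. B k" "B k" P] B(1) by (meson INT_lower UNIV_I order_trans)
    have "(\<lambda>k. 1 / real (Suc k)) \<longlonglongrightarrow> 0" using LIMSEQ_inverse_real_of_nat by (simp add: field_simps)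
    then have "(\<lambda>k. C * (1 / real (Suc k)) powr s') \<longlonglongrightarrow> C * 0 powr s'"
      using \<open>s' > 0\<close> by (intro tendsto_intros) auto
    then have "(\<lambda>k. ennreal (C * (1 / real (Suc k)) powr s')) \<longlonglongrightarrow> ennreal 0"
      by (intro tendsto_ennrealI) simp
    then have "emeasure P (\<Inter>k. B k) \<le> ennreal 0"
      by (rule LIMSEQ_le_const) (use le in auto)
    moreover have "(\<Inter>k. B k) \<in> sets P" using B(1) by auto
    ultimately show ?thesis using B(2) by (intro bexI[of _ "\<Inter>k. B k"]) auto
  qed
  assume "hausdorff_measure s E = 0"
  then have "hausdorff_approx s 1 E \<le> 0"
    using SUP_upper[of 1 "{0<..}" "\<lambda>d. hausdorff_approx s d E"] by (simp add: hausdorff_measure_def)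
  then have "hausdorff_approx s 1 E < ennreal (1 / C)"
    by (rule le_less_trans) (use \<open>C > 0\<close> in simp)
  then have "\<exists>U\<in>{U :: nat \<Rightarrow> 'a set. E \<subseteq> (\<Union>i. U i) \<and> (\<forall>i. bounded (U i) \<and> diameter (U i) \<le> 1)}.
      (\<Sum>i. ennreal (diameter (U i) powr s)) < ennreal (1 / C)"
    unfolding hausdorff_approx_def INF_less_iff .
  then obtain U :: "nat \<Rightarrow> 'a set" where U: "E \<subseteq> (\<Union>i. U i)"
    "\<And>i. bounded (U i)" "\<And>i. diameter (U i) \<le> 1"
    "(\<Sum>i. ennreal (diameter (U i) powr s)) < ennreal (1 / C)"
    by blast
  obtain B where B: "\<And>i. B i \<in> sets P" "\<And>i. {\<omega>\<in>space P. f \<omega> \<in> U i} \<subseteq> B i"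
    "\<And>i. emeasure P (B i) \<le> ennreal (C * diameter (U i) powr s)"
    using A'[OF U(2,3)] by metis
  have "space P \<subseteq> (\<Union>i. B i)" using f U(1) B(2) by blast
  then have "1 \<le> emeasure P (\<Union>i. B i)"
    using emeasure_mono[of "space P" "\<Union>i. B i" P] B(1) by (simp add: emeasure_space_1)
  also have "\<dots> \<le> (\<Sum>i. emeasure P (B i))"
    using B(1) by (intro emeasure_subadditive_countably) auto
  also have "\<dots> \<le> (\<Sum>i. ennreal C * ennreal (diameter (U i) powr s))"
  proof (intro suminf_le summableI)
    show "emeasure P (B i) \<le> ennreal C * ennreal (diameter (U i) powr s)" for i
      using B(3)[of i] \<open>C > 0\<close> ennreal_mult[of C "diameter (U i) powr s"] by simp
  qed
  also have "\<dots> = ennreal C * (\<Sum>i. ennreal (diameter (U i) powr s))" by simp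
  also have "\<dots> < ennreal C * ennreal (1 / C)"
    using U(4) \<open>C > 0\<close> by (intro ennreal_mult_strict_left_mono) auto
  also have "\<dots> = 1" using \<open>C > 0\<close> ennreal_mult[of C "1 / C"] by simp
  finally show False by simp
qed

lemma hausdorff_dim_le:
  assumes "0 \<le> s" "hausdorff_measure s E = 0"
  shows "hausdorff_dim E \<le> s"
  unfolding hausdorff_dim_def using assms by (intro cInf_lower bdd_belowI[of _ 0]) auto

text \<open>\<open>Inf\<close> of an empty set of reals is unspecified, so a lower bound for the
  dimension needs one exponent \<open>s\<^sub>1\<close> of measure zero as a witness.\<close>

lemma hausdorff_dim_ge:
  assumes "0 \<le> s\<^sub>1" "hausdorff_measure s\<^sub>1 E = 0"
    and "\<And>s. 0 \<le> s \<Longrightarrow> s < d \<Longrightarrow> hausdorff_measure s E \<noteq> 0"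
  shows "d \<le> hausdorff_dim E"
  unfolding hausdorff_dim_def using assms by (intro cInf_greatest) (auto simp: not_less[symmetric])

section \<open>Digit expansions\<close>

definition digit_sum :: "nat \<Rightarrow> (nat \<Rightarrow> nat) \<Rightarrow> real" where
  "digit_sum a w = (\<Sum>n. real (w n) / real a ^ Suc n)"

text \<open>Horner value of the first \<open>p\<close> digits: the integer that labels a cell of
  level \<open>p\<close> in the base-\<open>a\<close> grid.\<close>

primrec prefix_code :: "nat \<Rightarrow> nat \<Rightarrow> (nat \<Rightarrow> nat) \<Rightarrow> nat" where
  "prefix_code a 0 w = 0"
| "prefix_code a (Suc p) w = a * prefix_code a p w + w p"

lemma digit_geometric_sums:
  assumes "a \<ge> (2::nat)"
  shows "(\<lambda>n. real (a - 1) / real a ^ Suc n) sums 1"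
proof -
  have "(\<lambda>n. real (a - 1) / real a * (1 / real a) ^ n) sums (real (a - 1) / real a * (1 / (1 - 1 / real a)))"
    using assms by (intro sums_mult geometric_sums) auto
  moreover have "real (a - 1) / real a * (1 / (1 - 1 / real a)) = 1"
    using assms by (simp add: field_simps)
  moreover have "real (a - 1) / real a * (1 / real a) ^ n = real (a - 1) / real a ^ Suc n" for n
    by (simp add: power_divide)
  ultimately show ?thesis by (simp only:)
qed

lemma digit_term_le:
  assumes "k < a"
  shows "real k / real a ^ Suc n \<le> real (a - 1) / real a ^ Suc n"
  using assms by (intro divide_right_mono) auto

lemma digit_sum_summable:
  assumes "a \<ge> 2" "\<And>n. w n < a"
  shows "summable (\<lambda>n. real (w n) / real a ^ Suc n)"
  using digit_term_le[OF assms(2)]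
  by (intro summable_comparison_test'[OF sums_summable[OF digit_geometric_sums[OF assms(1)]]]) auto

lemma digit_sum_bounds:
  assumes "a \<ge> 2" "\<And>n. w n < a"
  shows "0 \<le> digit_sum a w" "digit_sum a w \<le> 1"
proof -
  show "0 \<le> digit_sum a w" unfolding digit_sum_def
    using digit_sum_summable[OF assms] by (intro suminf_nonneg) auto
  have "digit_sum a w \<le> (\<Sum>n. real (a - 1) / real a ^ Suc n)" unfolding digit_sum_def
    using digit_sum_summable[OF assms] digit_geometric_sums[OF assms(1)] digit_term_le[OF assms(2)]
    by (intro suminf_le) (auto simp: sums_iff)
  then show "digit_sum a w \<le> 1" using digit_geometric_sums[OF assms(1)] by (simp add: sums_iff)
qed

lemma digit_sum_unfold:
  assumes "a \<ge> 2" "\<And>n. w n < a"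
  shows "digit_sum a w = (digit_sum a (\<lambda>n. w (Suc n)) + real (w 0)) / real a"
proof -
  have "digit_sum a w = real (w 0) / real a + (\<Sum>n. real (w (Suc n)) / real a ^ Suc (Suc n))"
    using suminf_split_head[OF digit_sum_summable[of a w, OF assms]] by (simp add: digit_sum_def)
  also have "(\<Sum>n. real (w (Suc n)) / real a ^ Suc (Suc n)) = (\<Sum>n. (real (w (Suc n)) / real a ^ Suc n) / real a)"
    by (simp add: field_simps)
  also have "\<dots> = digit_sum a (\<lambda>n. w (Suc n)) / real a" unfolding digit_sum_def
    by (rule suminf_divide) (rule digit_sum_summable[of a "\<lambda>n. w (Suc n)", OF assms])
  finally show ?thesis by (simp add: add_divide_distrib)
qed

text \<open>Multiplication by \<open>a ^ p\<close> shifts the digits, up to an integer. Cells,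
  closeness of points and distances to the nearest integer are all read off from this
  identity.\<close>

lemma power_mult_digit_sum:
  assumes "a \<ge> 2" "\<And>n. w n < a"
  shows "real a ^ p * digit_sum a w = real (prefix_code a p w) + digit_sum a (\<lambda>i. w (p + i))"
proof (induction p)
  case 0 then show ?case by simp
next
  case (Suc p)
  have "digit_sum a (\<lambda>i. w (p + i)) = (digit_sum a (\<lambda>i. w (Suc p + i)) + real (w p)) / real a"
    using digit_sum_unfold[of a "\<lambda>i. w (p + i)"] assms by simp
  then show ?case using Suc assms(1) by (simp add: field_simps)
qed

lemma prefix_code_add:
  "prefix_code a (i + j) w = prefix_code a i w * a ^ j + prefix_code a j (\<lambda>k. w (i + k))"
  by (induction j) (auto simp: algebra_simps)

lemma prefix_code_cong:
  "(\<And>i. i < p \<Longrightarrow> w i = w' i) \<Longrightarrow> prefix_code a p w = prefix_code a p w'"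
  by (induction p) auto

lemma prefix_code_inj:
  assumes "prefix_code a p w = prefix_code a p w'" "\<And>n. w n < a" "\<And>n. w' n < a" "i < p"
  shows "w i = w' i"
  using assms(1,4)
proof (induction p)
  case (Suc p)
  have "w p = w' p"
    using arg_cong[OF Suc.prems(1), of "\<lambda>z. z mod a"] assms(2,3)[of p] by simp
  moreover have "prefix_code a p w = prefix_code a p w'"
    using Suc.prems(1) calculation assms(2)[of p] by simp
  ultimately show ?case using Suc by (cases "i = p") auto
qed simp

text \<open>After scaling, the sums differ by at most 1 and both tails lie in [0, 1], so the labels
  differ by at most 2. Truncated subtraction can only shorten the interval: at most five labels
  arise.\<close>

lemma prefix_code_close:
  assumes "a \<ge> 2" "\<And>n. w n < a" "\<And>n. w' n < a"
    and "\<bar>digit_sum a w - digit_sum a w'\<bar> \<le> 1 / real a ^ p"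
  shows "prefix_code a p w \<in> {prefix_code a p w' - 2..prefix_code a p w' + 2}"
proof -
  have "\<bar>real a ^ p * digit_sum a w - real a ^ p * digit_sum a w'\<bar> = real a ^ p * \<bar>digit_sum a w - digit_sum a w'\<bar>"
    by (simp add: abs_mult flip: right_diff_distrib)
  also have "\<dots> \<le> real a ^ p * (1 / real a ^ p)"
    using assms(4) by (intro mult_left_mono) auto
  also have "\<dots> = 1" using assms(1) by simp
  finally show ?thesis
    using power_mult_digit_sum[of a w p] power_mult_digit_sum[of a w' p] assms(1-3)
      digit_sum_bounds[of a "\<lambda>i. w (p + i)"] digit_sum_bounds[of a "\<lambda>i. w' (p + i)"] by auto
qed

lemma digit_sum_agree:
  assumes "a \<ge> 2" "\<And>n. w n < a" "\<And>n. w' n < a" "\<And>i. i < m \<Longrightarrow> w i = w' i"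
  shows "\<bar>digit_sum a w - digit_sum a w'\<bar> \<le> 1 / real a ^ m"
proof -
  have "real a ^ m * \<bar>digit_sum a w - digit_sum a w'\<bar> = \<bar>real a ^ m * digit_sum a w - real a ^ m * digit_sum a w'\<bar>"
    by (simp add: abs_mult flip: right_diff_distrib)
  also have "\<dots> \<le> 1"
    using power_mult_digit_sum[of a w m] power_mult_digit_sum[of a w' m] assms
      prefix_code_cong[of m w w' a]
      digit_sum_bounds[of a "\<lambda>i. w (m + i)"] digit_sum_bounds[of a "\<lambda>i. w' (m + i)"] by auto
  finally show ?thesis using assms(1) by (simp add: field_simps)
qed

lemma dist_int_bounds: "0 \<le> dist_int x" "dist_int x \<le> 1 / 2"
  unfolding dist_int_def using frac_ge_0[of x] frac_lt_1[of x] by (auto simp: min_def)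

lemma dist_int_le: "dist_int x \<le> \<bar>x - of_int k\<bar>"
proof -
  have fr: "frac x = x - of_int \<lfloor>x\<rfloor>" by (simp add: frac_def)
  have "k \<le> \<lfloor>x\<rfloor> \<or> k \<ge> \<lfloor>x\<rfloor> + 1" by linarith
  then show ?thesis
  proof
    assume "k \<le> \<lfloor>x\<rfloor>"
    then have "of_int k \<le> (of_int \<lfloor>x\<rfloor> :: real)" by simp
    then show ?thesis using of_int_floor_le[of x] unfolding dist_int_def fr by linarith
  next
    assume "k \<ge> \<lfloor>x\<rfloor> + 1"
    then have "of_int k \<ge> (of_int (\<lfloor>x\<rfloor> + 1) :: real)" by linarith
    then show ?thesis using real_of_int_floor_add_one_gt[of x] unfolding dist_int_def fr by simp
  qed
qed

lemma dist_int_attained: "\<exists>k. dist_int x = \<bar>x - of_int k\<bar>"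
proof -
  have "frac x = \<bar>x - of_int \<lfloor>x\<rfloor>\<bar>" "1 - frac x = \<bar>x - of_int (\<lfloor>x\<rfloor> + 1)\<bar>"
    using of_int_floor_le[of x] real_of_int_floor_add_one_gt[of x] by (auto simp: frac_def)
  then show ?thesis unfolding dist_int_def min_def by metis
qed

section \<open>Digit words as coordinates on the attractor\<close>

locale restricted_digits =
  fixes a :: nat and \<Lambda> :: "nat set"
  assumes base: "a \<ge> 3" and digits: "\<Lambda> \<subseteq> {0..<a}" and card_digits: "card \<Lambda> \<ge> 2"
begin

lemma finite_digits: "finite \<Lambda>"
  using digits finite_subset by blast

lemma digits_nonempty: "\<Lambda> \<noteq> {}"
  using card_digits by auto

lemma base2: "a \<ge> 2"
  using base by simp

lemma digit_less: "w \<in> UNIV \<rightarrow> \<Lambda> \<Longrightarrow> w n < a"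
  using digits Pi_mem[of w UNIV "\<lambda>_. \<Lambda>" n] by auto

lemma digit_sum_unfold_digits:
  "w \<in> UNIV \<rightarrow> \<Lambda> \<Longrightarrow> digit_sum a w = (digit_sum a (\<lambda>n. w (Suc n)) + real (w 0)) / real a"
  by (rule digit_sum_unfold[OF base2], rule digit_less)

lemma power_mult_digit_sum_digits:
  "w \<in> UNIV \<rightarrow> \<Lambda> \<Longrightarrow> real a ^ p * digit_sum a w = real (prefix_code a p w) + digit_sum a (\<lambda>i. w (p + i))"
  by (rule power_mult_digit_sum[OF base2], rule digit_less)

lemma digit_sum_shift_bounds:
  "w \<in> UNIV \<rightarrow> \<Lambda> \<Longrightarrow> 0 \<le> digit_sum a (\<lambda>i. w (p + i))"
  "w \<in> UNIV \<rightarrow> \<Lambda> \<Longrightarrow> digit_sum a (\<lambda>i. w (p + i)) \<le> 1"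
  by (rule digit_sum_bounds[OF base2], erule digit_less)+

text \<open>The digit space is compact by Tychonoff, and the partial sums converge uniformly on it,
  so \<open>digit_sum\<close> is continuous there.\<close>

lemma compact_digit_sum_image: "compact (digit_sum a ` (UNIV \<rightarrow> \<Lambda>))"
proof (rule compact_continuous_image)
  have *: "uniform_limit (UNIV \<rightarrow> \<Lambda>) (\<lambda>n w. \<Sum>i<n. real (w i) / real a ^ Suc i)
      (\<lambda>w. \<Sum>i. real (w i) / real a ^ Suc i) sequentially"
    by (intro Weierstrass_m_test[OF _ sums_summable[OF digit_geometric_sums[OF base2]]])
      (use digit_term_le[OF digit_less] in simp)
  have "continuous_on (UNIV \<rightarrow> \<Lambda>) (\<lambda>w. real (w i))" for i :: nat
    by (intro continuous_on_of_nat continuous_on_subset[OF continuous_on_product_coordinates]) auto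
  then have "continuous_on (UNIV \<rightarrow> \<Lambda>) (\<lambda>w. \<Sum>i. real (w i) / real a ^ Suc i)"
    using base by (intro uniform_limit_theorem[OF _ *] always_eventually allI continuous_on_sum
        continuous_on_divide continuous_on_const) auto
  then show "continuous_on (UNIV \<rightarrow> \<Lambda>) (digit_sum a)"
    unfolding digit_sum_def .
  have "compactin (product_topology (\<lambda>i. euclidean) (UNIV :: nat set)) (PiE UNIV (\<lambda>_. \<Lambda>))"
    unfolding compactin_PiE using finite_imp_compact[OF finite_digits] by simp
  then show "compact (UNIV \<rightarrow> \<Lambda> :: (nat \<Rightarrow> nat) set)"
    by (simp add: euclidean_product_topology PiE_UNIV_domain)
qed

lemma digit_sum_image_self_similar:
  "digit_sum a ` (UNIV \<rightarrow> \<Lambda>) = (\<Union>k\<in>\<Lambda>. (\<lambda>x. (x + real k) / real a) ` digit_sum a ` (UNIV \<rightarrow> \<Lambda>))"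
  (is "?K = ?R")
proof (intro equalityI subsetI)
  fix x assume "x \<in> ?K"
  then obtain w where w: "w \<in> UNIV \<rightarrow> \<Lambda>" "x = digit_sum a w" by blast
  then have "x = (digit_sum a (\<lambda>n. w (Suc n)) + real (w 0)) / real a"
    using digit_sum_unfold_digits[OF w(1)] by simp
  moreover have "(\<lambda>n. w (Suc n)) \<in> UNIV \<rightarrow> \<Lambda>" "w 0 \<in> \<Lambda>" using w by auto
  ultimately show "x \<in> ?R" by (intro UN_I[of "w 0"] image_eqI[OF _ imageI]) auto
next
  fix x assume "x \<in> ?R"
  then obtain k w where w: "k \<in> \<Lambda>" "w \<in> UNIV \<rightarrow> \<Lambda>" "x = (digit_sum a w + real k) / real a" by auto
  define w' where "w' = case_nat k w"
  have w': "w' \<in> UNIV \<rightarrow> \<Lambda>" using w by (auto simp: w'_def Pi_iff split: nat.split)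
  have "digit_sum a w' = x"
    using digit_sum_unfold_digits[OF w'] w(3) by (simp add: w'_def)
  then show "x \<in> ?K" using w' by (intro image_eqI[of _ _ w']) auto
qed

text \<open>A point of \<open>K\<close> and a digit sum with the same first \<open>p\<close> digits
  are at most \<open>(B + 1) / a ^ p\<close> apart. Letting \<open>p\<close> grow gives one
  inclusion, closedness of \<open>K\<close> the other. This uniqueness makes the definite
  description in \<open>attractor\<close> usable.\<close>

lemma self_similar_unique:
  assumes K: "compact K" "K \<noteq> {}" "K = (\<Union>k\<in>\<Lambda>. (\<lambda>x. (x + real k) / real a) ` K)"
  shows "K = digit_sum a ` (UNIV \<rightarrow> \<Lambda>)"
proof (intro equalityI subsetI)
  have K_step: "\<exists>y k. y \<in> K \<and> k \<in> \<Lambda> \<and> real a * x = y + real k" if x: "x \<in> K" for x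
  proof -
    obtain y k where "y \<in> K" "k \<in> \<Lambda>" "x = (y + real k) / real a"
      using subsetD[OF equalityD1[OF K(3)] x] by (elim UN_E imageE)
    then show ?thesis using base by (intro exI[of _ y] exI[of _ k]) simp
  qed
  have K_image: "(y + real k) / real a \<in> K" if "y \<in> K" "k \<in> \<Lambda>" for y k
    by (rule subsetD[OF equalityD2[OF K(3)] UN_I[OF that(2) imageI[OF that(1)]]])
  obtain B where B: "\<And>x. x \<in> K \<Longrightarrow> \<bar>x\<bar> \<le> B" using compact_imp_bounded[OF K(1)]
    by (auto simp: bounded_iff)
  have lim: "(\<lambda>p. (B + 1) * (1 / real a) ^ p) \<longlonglongrightarrow> (B + 1) * 0"
    using base by (intro tendsto_mult tendsto_const LIMSEQ_power_zero) auto
  have close: "\<bar>z - u\<bar> \<le> (B + 1) * (1 / real a) ^ p"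
    if "real a ^ p * z = c + x" "real a ^ p * u = c + v" "x \<in> K" "0 \<le> v" "v \<le> 1" for z u c x v p
  proof -
    have "real a ^ p * \<bar>z - u\<bar> = \<bar>real a ^ p * (z - u)\<bar>" by (simp add: abs_mult)
    also have "real a ^ p * (z - u) = x - v" unfolding right_diff_distrib that(1,2) by simp
    also have "\<bar>x - v\<bar> \<le> B + 1" using B[OF that(3)] that(4,5) by linarith
    finally show ?thesis using base by (simp add: field_simps power_divide)
  qed
  {
    fix x assume x: "x \<in> K"
    \<comment> \<open>\<open>k\<close> picks a first digit of a point of \<open>K\<close> and
      \<open>g\<close> the point that remains; iterating \<open>g\<close> reads off a digit
      word.\<close>
    obtain g k where g: "\<And>x. x \<in> K \<Longrightarrow> g x \<in> K" "\<And>x. x \<in> K \<Longrightarrow> k x \<in> \<Lambda>"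
      "\<And>x. x \<in> K \<Longrightarrow> real a * x = g x + real (k x)"
      using K_step by metis
    define w where "w n = k ((g ^^ n) x)" for n
    have gn: "(g ^^ n) x \<in> K" for n by (induction n) (use g(1) x in auto)
    have w: "w \<in> UNIV \<rightarrow> \<Lambda>" using g(2) gn by (auto simp: w_def)
    have "real a ^ p * x = real (prefix_code a p w) + (g ^^ p) x" for p
    proof (induction p)
      case (Suc p)
      have "real a * (g ^^ p) x = (g ^^ Suc p) x + real (w p)"
        using g(3)[OF gn[of p]] by (simp add: w_def)
      moreover have "real a ^ Suc p * x = real a * (real a ^ p * x)" by simp
      ultimately show ?case unfolding Suc by (simp add: algebra_simps)
    qed simp
    then have "\<bar>x - digit_sum a w\<bar> \<le> (B + 1) * (1 / real a) ^ p" for p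
      using close[OF _ power_mult_digit_sum_digits[OF w] gn digit_sum_shift_bounds[OF w]] by blast
    then have "\<bar>x - digit_sum a w\<bar> \<le> (B + 1) * 0"
      by (intro LIMSEQ_le_const[OF lim]) auto
    then show "x \<in> digit_sum a ` (UNIV \<rightarrow> \<Lambda>)" using w by auto
  }
  {
    fix x assume "x \<in> digit_sum a ` (UNIV \<rightarrow> \<Lambda>)"
    then obtain w where w: "w \<in> UNIV \<rightarrow> \<Lambda>" "x = digit_sum a w" by blast
    obtain z where z: "z \<in> K" using K(2) by blast
    \<comment> \<open>The first digit belongs to the map applied last, so the induction strips
      digits from the front and generalises over the word.\<close>
    have "\<exists>y\<in>K. real a ^ p * y = real (prefix_code a p v) + z" if "v \<in> UNIV \<rightarrow> \<Lambda>" for p v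
      using that
    proof (induction p arbitrary: v)
      case (Suc p)
      obtain y where y: "y \<in> K" "real a ^ p * y = real (prefix_code a p (\<lambda>i. v (Suc i))) + z"
        using Suc.IH[of "\<lambda>i. v (Suc i)"] Suc.prems by auto
      have "v 0 \<in> \<Lambda>" using Suc.prems by auto
      then have "(y + real (v 0)) / real a \<in> K" using y(1) by (intro K_image)
      moreover have "prefix_code a (Suc p) v = v 0 * a ^ p + prefix_code a p (\<lambda>i. v (Suc i))"
        using prefix_code_add[of a 1 p v] by simp
      ultimately show ?case using y(2) base
        by (intro bexI[of _ "(y + real (v 0)) / real a"]) (auto simp: field_simps)
    qed (use z in auto)
    then obtain y where y: "\<And>p. y p \<in> K" "\<And>p. real a ^ p * y p = real (prefix_code a p w) + z"
      using w(1) by metis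
    have "\<bar>y p - x\<bar> \<le> (B + 1) * (1 / real a) ^ p" for p
      using close[OF y(2) power_mult_digit_sum_digits[OF w(1)] z digit_sum_shift_bounds[OF w(1)]] w(2)
      by blast
    then have "(\<lambda>p. y p - x) \<longlonglongrightarrow> 0"
      by (intro Lim_null_comparison[OF _ lim[simplified]]) auto
    then have "y \<longlonglongrightarrow> x" by (simp add: LIM_zero_iff)
    then show "x \<in> K" using y(1) compact_imp_closed[OF K(1)] closed_sequentially by blast
  }
qed

lemma attractor_eq: "attractor a \<Lambda> = digit_sum a ` (UNIV \<rightarrow> \<Lambda>)"
  unfolding attractor_def
proof (rule the_equality)
  show "compact (digit_sum a ` (UNIV \<rightarrow> \<Lambda>)) \<and> digit_sum a ` (UNIV \<rightarrow> \<Lambda>) \<noteq> {} \<and>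
      digit_sum a ` (UNIV \<rightarrow> \<Lambda>) = (\<Union>k\<in>\<Lambda>. (\<lambda>x. (x + real k) / real a) ` digit_sum a ` (UNIV \<rightarrow> \<Lambda>))"
    using compact_digit_sum_image digit_sum_image_self_similar digits_nonempty
    by (intro conjI) (simp_all only: image_is_empty Pi_eq_empty, auto)
qed (elim conjE, rule self_similar_unique)

end

section \<open>Measures with forced digits\<close>

context restricted_digits
begin

definition sim_dim :: real where
  "sim_dim = ln (real (card \<Lambda>)) / ln (real a)"

lemma ln_base_ge_1: "ln (real a) \<ge> 1"
proof -
  have "exp 1 \<le> real a" using exp_le base by linarith
  then show ?thesis using base by (subst ln_ge_iff) auto
qed

lemma sim_dim_pos: "sim_dim > 0"
  unfolding sim_dim_def using card_digits ln_base_ge_1 by (intro divide_pos_pos) auto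

lemma card_digits_power: "real (card \<Lambda>) ^ k = exp (sim_dim * ln (real a) * real k)"
proof -
  have "exp (sim_dim * ln (real a)) = real (card \<Lambda>)"
    unfolding sim_dim_def using card_digits ln_base_ge_1 by simp
  then show ?thesis by (metis exp_of_nat2_mult)
qed

lemma base_power: "real a ^ k = exp (ln (real a) * real k)"
  using base by (simp add: exp_of_nat2_mult)

text \<open>A forced digit is encoded as the uniform measure on a singleton, so one product of
  uniform measures treats forced and free positions alike.\<close>

definition forced_measure :: "nat set \<Rightarrow> (nat \<Rightarrow> nat) \<Rightarrow> (nat \<Rightarrow> nat) measure" where
  "forced_measure F z = PiM UNIV (\<lambda>n. uniform_count_measure (if n \<in> F then {z n} else \<Lambda>))"

lemma space_forced_measure:
  "space (forced_measure F z) = {w. \<forall>n. w n \<in> (if n \<in> F then {z n} else \<Lambda>)}"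
  by (simp add: forced_measure_def space_PiM space_uniform_count_measure PiE_UNIV_domain Pi_def)

lemma space_forced_measure_digits:
  assumes "z \<in> UNIV \<rightarrow> \<Lambda>" "w \<in> space (forced_measure F z)"
  shows "w \<in> UNIV \<rightarrow> \<Lambda>"
proof
  fix n show "w n \<in> \<Lambda>"
    using assms(2) Pi_mem[OF assms(1), of n] unfolding space_forced_measure by (cases "n \<in> F") (auto dest: spec[of _ n])
qed

lemma product_prob_space_forced:
  "product_prob_space (\<lambda>n. uniform_count_measure (if n \<in> F then {z n} else \<Lambda>))"
  using finite_digits digits_nonempty
  by (intro product_prob_spaceI prob_space_uniform_count_measure) auto

lemma prob_space_forced_measure: "prob_space (forced_measure F z)"
  unfolding forced_measure_def using finite_digits digits_nonempty
  by (intro prob_space_PiM prob_space_uniform_count_measure) auto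

text \<open>A nonempty code class is a cylinder: forced positions contribute the factor 1, free ones
  \<open>1 / card \<Lambda>\<close>. It is only an upper bound because a code that contradicts the
  forced digits has an empty class.\<close>

lemma emeasure_prefix_code_eq:
  assumes z: "z \<in> UNIV \<rightarrow> \<Lambda>"
  shows "{w \<in> space (forced_measure F z). prefix_code a p w = c} \<in> sets (forced_measure F z)" (is "?S \<in> _")
    and "emeasure (forced_measure F z) {w \<in> space (forced_measure F z). prefix_code a p w = c}
      \<le> ennreal ((1 / real (card \<Lambda>)) ^ card ({..<p} - F))"
proof -
  let ?D = "\<lambda>n. if n \<in> F then {z n} else \<Lambda>"
  let ?M = "\<lambda>n. uniform_count_measure (?D n)"
  interpret product_prob_space ?M UNIV by (rule product_prob_space_forced)
  have "?S \<in> sets (forced_measure F z) \<and>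
    emeasure (forced_measure F z) ?S \<le> ennreal ((1 / real (card \<Lambda>)) ^ card ({..<p} - F))"
  proof (cases "?S = {}")
    case True then show ?thesis unfolding True by simp
  next
    case False
    then obtain w where w: "w \<in> space (forced_measure F z)" "prefix_code a p w = c" by blast
    have wD: "w n \<in> ?D n" for n using w(1) unfolding space_forced_measure by blast
    have wL: "w \<in> UNIV \<rightarrow> \<Lambda>" using space_forced_measure_digits[OF z w(1)] .
    have eq: "?S = prod_emb UNIV ?M {..<p} (PiE {..<p} (\<lambda>i. {w i}))"
    proof (intro equalityI subsetI)
      fix v assume v: "v \<in> ?S"
      then have vL: "v \<in> UNIV \<rightarrow> \<Lambda>" using space_forced_measure_digits[OF z] by blast
      have "v i = w i" if "i < p" for i
        by (rule prefix_code_inj[of a p v w, OF _ digit_less[OF vL] digit_less[OF wL] that]) (use v w in simp)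
      then show "v \<in> prod_emb UNIV ?M {..<p} (PiE {..<p} (\<lambda>i. {w i}))"
        using v by (auto simp: prod_emb_iff forced_measure_def space_PiM PiE_UNIV_domain Pi_iff restrict_PiE_iff)
    next
      fix v assume v: "v \<in> prod_emb UNIV ?M {..<p} (PiE {..<p} (\<lambda>i. {w i}))"
      then have "v i = w i" if "i < p" for i using that by (auto simp: prod_emb_iff restrict_PiE_iff)
      then have "prefix_code a p v = c" using w(2) prefix_code_cong[of p v w a] by simp
      moreover have "v \<in> space (forced_measure F z)"
        using v by (auto simp: prod_emb_iff forced_measure_def space_PiM PiE_UNIV_domain Pi_iff)
      ultimately show "v \<in> ?S" by simp
    qed
    have sets: "{w i} \<in> sets (?M i)" for i using wD[of i] by (simp add: sets_uniform_count_measure)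
    have "emeasure (forced_measure F z) ?S = (\<Prod>i<p. emeasure (?M i) {w i})"
      unfolding eq unfolding forced_measure_def
      by (intro emeasure_PiM_emb) (auto simp: sets simp del: sets_uniform_count_measure)
    also have "\<dots> = (\<Prod>i<p. ennreal (if i \<in> F then 1 else 1 / real (card \<Lambda>)))"
    proof (rule prod.cong[OF refl])
      fix i show "emeasure (?M i) {w i} = ennreal (if i \<in> F then 1 else 1 / real (card \<Lambda>))"
        using wD[of i] finite_digits by (cases "i \<in> F") (auto simp: emeasure_uniform_count_measure)
    qed
    also have "\<dots> = ennreal (\<Prod>i<p. if i \<in> F then 1 else 1 / real (card \<Lambda>))"
      by (intro prod_ennreal) auto
    also have "(\<Prod>i<p. if i \<in> F then 1 else 1 / real (card \<Lambda>)) = (1 / real (card \<Lambda>)) ^ card ({..<p} - F)"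
      by (subst prod.If_cases) (auto simp: Diff_eq)
    finally have "emeasure (forced_measure F z) ?S = ennreal ((1 / real (card \<Lambda>)) ^ card ({..<p} - F))" .
    moreover have "?S \<in> sets (forced_measure F z)"
      unfolding eq unfolding forced_measure_def by (intro sets_PiM_I) (auto simp: sets)
    ultimately show ?thesis by simp
  qed
  then show "?S \<in> sets (forced_measure F z)"
    "emeasure (forced_measure F z) ?S \<le> ennreal ((1 / real (card \<Lambda>)) ^ card ({..<p} - F))" by auto
qed

text \<open>\<open>p\<close> is the finest level whose cells still have length at least
  \<open>r\<close>, so at most five codes occur within distance \<open>r\<close>. Rounding
  \<open>p\<close> down loses less than one digit, which is the summand \<open>ln (real a)\<close>
  in the exponent.\<close>

lemma forced_measure_ball:
  assumes z: "z \<in> UNIV \<rightarrow> \<Lambda>" and w0: "w0 \<in> space (forced_measure F z)"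
    and r: "0 < r" "r \<le> 1" and p: "p = nat \<lfloor>- ln r / ln (real a)\<rfloor>"
  shows "\<exists>A\<in>sets (forced_measure F z).
    {w \<in> space (forced_measure F z). \<bar>digit_sum a w - digit_sum a w0\<bar> \<le> r} \<subseteq> A \<and>
    emeasure (forced_measure F z) A
      \<le> ennreal (5 * exp (sim_dim * (ln (real a) + ln r + ln (real a) * real (card ({..<p} \<inter> F)))))"
proof -
  let ?P = "forced_measure F z"
  let ?L = "ln (real a)"
  define c where "c = prefix_code a p w0"
  define B where "B j = {w \<in> space ?P. prefix_code a p w = j}" for j
  define A where "A = (\<Union>j\<in>{c - 2..c + 2}. B j)"
  have L: "?L \<ge> 1" by (rule ln_base_ge_1)
  have lr: "ln r \<le> 0" using r by simp
  then have "real p \<le> - ln r / ?L" unfolding p using L by (intro of_nat_floor) (simp add: divide_nonpos_pos)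
  then have "ln r \<le> - (?L * real p)" using L by (simp add: field_simps)
  then have "exp (ln r) \<le> exp (- (?L * real p))" by (rule exp_le_cancel_iff[THEN iffD2])
  then have rp: "r \<le> 1 / real a ^ p" using r by (simp add: base_power exp_minus field_simps)
  have "- ln r / ?L < real p + 1" unfolding p by linarith
  then have pr: "- ln r < ?L * (real p + 1)" using L by (simp add: field_simps)
  have sub: "{w \<in> space ?P. \<bar>digit_sum a w - digit_sum a w0\<bar> \<le> r} \<subseteq> A"
  proof
    fix w assume w: "w \<in> {w \<in> space ?P. \<bar>digit_sum a w - digit_sum a w0\<bar> \<le> r}"
    then have "\<bar>digit_sum a w - digit_sum a w0\<bar> \<le> 1 / real a ^ p" using rp by auto
    then have "prefix_code a p w \<in> {c - 2..c + 2}" unfolding c_def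
      using w space_forced_measure_digits[OF z] w0 by (intro prefix_code_close[OF base2] digit_less) auto
    then show "w \<in> A" using w by (auto simp: A_def B_def)
  qed
  have B: "B j \<in> sets ?P" "emeasure ?P (B j) \<le> ennreal ((1 / real (card \<Lambda>)) ^ card ({..<p} - F))" for j
    unfolding B_def using emeasure_prefix_code_eq[OF z] by auto
  have "emeasure ?P A \<le> (\<Sum>j\<in>{c - 2..c + 2}. emeasure ?P (B j))"
    unfolding A_def by (intro emeasure_subadditive_finite) (use B in auto)
  also have "\<dots> \<le> (\<Sum>j\<in>{c - 2..c + 2}. ennreal ((1 / real (card \<Lambda>)) ^ card ({..<p} - F)))"
    by (intro sum_mono B)
  also have "\<dots> = ennreal (real (card {c - 2..c + 2}) * (1 / real (card \<Lambda>)) ^ card ({..<p} - F))"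
    by (simp add: ennreal_mult ennreal_of_nat_eq_real_of_nat)
  also have "\<dots> \<le> ennreal (5 * exp (sim_dim * (?L + ln r + ?L * real (card ({..<p} \<inter> F)))))"
  proof (intro ennreal_leI mult_mono)
    have "card ({..<p} - F) + card ({..<p} \<inter> F) = p"
      using card_Diff_subset_Int[of "{..<p}" F] card_mono[of "{..<p}" "{..<p} \<inter> F"] by simp
    then have cd: "real (card ({..<p} - F)) = real p - real (card ({..<p} \<inter> F))" by linarith
    have "(1 / real (card \<Lambda>)) ^ card ({..<p} - F) = exp (- (sim_dim * ?L * real (card ({..<p} - F))))"
      by (simp add: power_divide card_digits_power exp_minus inverse_eq_divide)
    also have "- (sim_dim * ?L * real (card ({..<p} - F))) = sim_dim * (?L * real (card ({..<p} \<inter> F)) - ?L * real p)"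
      unfolding cd by (simp add: algebra_simps)
    also have "exp \<dots> \<le> exp (sim_dim * (?L + ln r + ?L * real (card ({..<p} \<inter> F))))"
      using pr sim_dim_pos by (intro exp_le_cancel_iff[THEN iffD2] mult_left_mono) (auto simp: algebra_simps)
    finally show "(1 / real (card \<Lambda>)) ^ card ({..<p} - F) \<le> exp (sim_dim * (?L + ln r + ?L * real (card ({..<p} \<inter> F))))" .
  qed auto
  finally show ?thesis using sub B(1) by (intro bexI[of _ A]) (auto simp: A_def)
qed

lemma dist_int_shifted_agree:
  assumes w: "w \<in> UNIV \<rightarrow> \<Lambda>" and e: "e \<in> UNIV \<rightarrow> \<Lambda>" and agree: "\<And>i. i < m \<Longrightarrow> w (n + i) = e i"
  shows "dist_int (real a ^ n * digit_sum a w - digit_sum a e) \<le> 1 / real a ^ m"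
proof -
  have "dist_int (real a ^ n * digit_sum a w - digit_sum a e)
      \<le> \<bar>real a ^ n * digit_sum a w - digit_sum a e - of_int (int (prefix_code a n w))\<bar>"
    by (rule dist_int_le)
  also have "\<dots> = \<bar>digit_sum a (\<lambda>i. w (n + i)) - digit_sum a e\<bar>"
    using power_mult_digit_sum_digits[OF w, of n] by simp
  also have "\<dots> \<le> 1 / real a ^ m"
    by (rule digit_sum_agree[OF base2 digit_less[OF w] digit_less[OF e] agree])
  finally show ?thesis .
qed

end

text \<open>Only windows up to \<open>K\<close> are visible, since \<open>p\<close> is at most
  \<open>\<rho>\<close>. Those before \<open>K\<close> sum to a geometric series, small against
  \<open>G ^ K\<close> when \<open>G\<close> is large. Window \<open>K\<close> counts with its
  length or its visible part, whichever is smaller; the last \<open>L\<close> is its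
  rounding.\<close>

lemma forced_window_count:
  fixes L U \<rho> :: real and G K p :: nat
  assumes L: "L \<ge> 1" and U: "U \<ge> 0" and G: "G \<ge> 2" and K: "real G ^ K \<le> \<rho>" "\<rho> < real G ^ Suc K"
    and p: "p = nat \<lfloor>\<rho> / L\<rfloor>" and m: "m = (\<lambda>k. nat \<lfloor>real G ^ k * U / L\<rfloor> + 1)"
  shows "L * real (card ({..<p} \<inter> (\<Union>k. {G ^ k..<G ^ k + m k})))
    \<le> (U + L) * (real G ^ K / (real G - 1)) + min (real G ^ K * U) (max 0 (\<rho> - real G ^ K * L)) + L"
proof -
  have \<rho>: "\<rho> \<ge> 0" using K(1) by (meson order_trans zero_le_power of_nat_0_le_iff)
  have "real p \<le> \<rho> / L" unfolding p using \<rho> L by (intro of_nat_floor) simp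
  then have pL: "L * real p \<le> \<rho>" using L by (simp add: field_simps)
  have "real p \<le> L * real p" using L by (simp add: mult_le_cancel_right1)
  then have p\<rho>: "real p \<le> \<rho>" using pL by simp
  have Lm: "L * real (m k) \<le> real G ^ k * U + L" for k
  proof -
    have "real (nat \<lfloor>real G ^ k * U / L\<rfloor>) \<le> real G ^ k * U / L" using L U by (intro of_nat_floor) simp
    then show ?thesis using L by (simp add: m field_simps)
  qed
  have sub: "{..<p} \<inter> (\<Union>k. {G ^ k..<G ^ k + m k})
      \<subseteq> (\<Union>j<K. {G ^ j..<G ^ j + m j}) \<union> {G ^ K..<min p (G ^ K + m K)}"
  proof
    fix x assume "x \<in> {..<p} \<inter> (\<Union>k. {G ^ k..<G ^ k + m k})"
    then obtain k where k: "x < p" "G ^ k \<le> x" "x < G ^ k + m k" by auto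
    have "real G ^ k < real p" unfolding of_nat_power[symmetric] using k by linarith
    then have "real G ^ k < real G ^ Suc K" using p\<rho> K(2) by linarith
    then have "k < Suc K" using G by (subst (asm) power_strict_increasing_iff) auto
    then show "x \<in> (\<Union>j<K. {G ^ j..<G ^ j + m j}) \<union> {G ^ K..<min p (G ^ K + m K)}"
      using k by (cases "k = K") auto
  qed
  have "card ({..<p} \<inter> (\<Union>k. {G ^ k..<G ^ k + m k}))
      \<le> card ((\<Union>j<K. {G ^ j..<G ^ j + m j}) \<union> {G ^ K..<min p (G ^ K + m K)})"
    using sub by (intro card_mono) auto
  also have "\<dots> \<le> card (\<Union>j<K. {G ^ j..<G ^ j + m j}) + card {G ^ K..<min p (G ^ K + m K)}"
    by (rule card_Un_le)
  also have "\<dots> \<le> (\<Sum>j<K. m j) + (min p (G ^ K + m K) - G ^ K)"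
    using card_UN_le[of "{..<K}" "\<lambda>j. {G ^ j..<G ^ j + m j}"] by simp
  finally have "real (card ({..<p} \<inter> (\<Union>k. {G ^ k..<G ^ k + m k})))
      \<le> (\<Sum>j<K. real (m j)) + real (min p (G ^ K + m K) - G ^ K)"
    by (metis of_nat_add of_nat_mono of_nat_sum)
  then have "L * real (card ({..<p} \<inter> (\<Union>k. {G ^ k..<G ^ k + m k})))
      \<le> L * ((\<Sum>j<K. real (m j)) + real (min p (G ^ K + m K) - G ^ K))"
    using L by (intro mult_left_mono) auto
  also have "\<dots> = (\<Sum>j<K. L * real (m j)) + L * real (min p (G ^ K + m K) - G ^ K)"
    by (simp add: distrib_left sum_distrib_left)
  also have "(\<Sum>j<K. L * real (m j)) \<le> (\<Sum>j<K. (U + L) * real G ^ j)"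
  proof (rule sum_mono)
    fix j
    \<comment> \<open>The rounding error \<open>L\<close> of each window is enlarged to
      \<open>L * real G ^ j\<close>, so that a single geometric series bounds everything.\<close>
    have "1 \<le> real G ^ j" using G by (intro one_le_power) auto
    then have "L \<le> L * real G ^ j" using L by (simp add: mult_le_cancel_left1)
    then show "L * real (m j) \<le> (U + L) * real G ^ j" using Lm[of j] by (simp add: algebra_simps)
  qed
  also have "(\<Sum>j<K. (U + L) * real G ^ j) = (U + L) * ((real G ^ K - 1) / (real G - 1))"
    using geometric_sum[of "real G" K] G by (simp flip: sum_distrib_left)
  also have "\<dots> \<le> (U + L) * (real G ^ K / (real G - 1))"
    using U L G by (intro mult_left_mono divide_right_mono) auto
  finally have 1: "L * real (card ({..<p} \<inter> (\<Union>k. {G ^ k..<G ^ k + m k})))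
      \<le> (U + L) * (real G ^ K / (real G - 1)) + L * real (min p (G ^ K + m K) - G ^ K)" by simp
  have "L * real (min p (G ^ K + m K) - G ^ K) \<le> L * real (m K)"
    using L by (intro mult_left_mono) auto
  then have 2: "L * real (min p (G ^ K + m K) - G ^ K) \<le> real G ^ K * U + L"
    using Lm[of K] by linarith
  have "L * real (min p (G ^ K + m K) - G ^ K) \<le> L * max 0 (real p - real G ^ K)"
    using L by (intro mult_left_mono) (auto simp: max_def of_nat_diff min_def)
  also have "\<dots> = max 0 (L * real p - real G ^ K * L)"
    using L by (simp add: max_def algebra_simps mult_le_cancel_left_pos)
  also have "\<dots> \<le> max 0 (\<rho> - real G ^ K * L)"
    using pL by (intro max.mono) auto
  finally have 3: "L * real (min p (G ^ K + m K) - G ^ K) \<le> max 0 (\<rho> - real G ^ K * L)" .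
  show ?thesis using 1 2 3 L by linarith
qed

section \<open>Lower bound\<close>

locale product_digits = A: restricted_digits a \<Lambda>a + B: restricted_digits b \<Lambda>b
  for a :: nat and \<Lambda>a :: "nat set" and b :: nat and \<Lambda>b :: "nat set" +
  fixes xo yo t :: real
  assumes xo: "xo \<in> attractor a \<Lambda>a" and yo: "yo \<in> attractor b \<Lambda>b" and t: "t > 0"
begin

abbreviation La where "La \<equiv> ln (real a)"
abbreviation Lb where "Lb \<equiv> ln (real b)"
abbreviation \<delta>\<^sub>1 where "\<delta>\<^sub>1 \<equiv> A.sim_dim"
abbreviation \<delta>\<^sub>2 where "\<delta>\<^sub>2 \<equiv> B.sim_dim"
abbreviation M where "M \<equiv> Mc a \<Lambda>a b \<Lambda>b xo yo t"

lemma forced_windows_mem_Mc: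
  fixes G :: nat and m l :: "nat \<Rightarrow> nat"
  assumes e: "e \<in> UNIV \<rightarrow> \<Lambda>a" "xo = digit_sum a e" and e': "e' \<in> UNIV \<rightarrow> \<Lambda>b" "yo = digit_sum b e'"
    and w: "w \<in> UNIV \<rightarrow> \<Lambda>a" "\<And>k i. i < m k \<Longrightarrow> w (G ^ k + i) = e i"
    and w': "w' \<in> UNIV \<rightarrow> \<Lambda>b" "\<And>k i. i < l k \<Longrightarrow> w' (G ^ k + i) = e' i"
    and G: "G \<ge> 2" and ml: "\<And>k. La * real (m k) + Lb * real (l k) > real (G ^ k) * t"
  shows "(digit_sum a w, digit_sum b w') \<in> M"
proof -
  have "G ^ k \<in> {n. dist_int (real a ^ n * digit_sum a w - xo) * dist_int (real b ^ n * digit_sum b w' - yo)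
                         < exp (- real n * t)}" for k
  proof -
    have "dist_int (real a ^ (G ^ k) * digit_sum a w - xo) * dist_int (real b ^ (G ^ k) * digit_sum b w' - yo)
        \<le> (1 / real a ^ m k) * (1 / real b ^ l k)"
      unfolding e(2) e'(2) using dist_int_bounds w w' e e'
      by (intro mult_mono A.dist_int_shifted_agree B.dist_int_shifted_agree) auto
    also have "\<dots> = exp (- (La * real (m k) + Lb * real (l k)))"
      by (simp only: A.base_power B.base_power minus_add_distrib exp_add exp_minus inverse_eq_divide)
    also have "\<dots> < exp (- real (G ^ k) * t)" using ml[of k] by simp
    finally show ?thesis by simp
  qed
  then have "range (\<lambda>k. G ^ k) \<subseteq> {n. dist_int (real a ^ n * digit_sum a w - xo) * dist_int (real b ^ n * digit_sum b w' - yo)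
                         < exp (- real n * t)}" by blast
  moreover have "infinite (range (\<lambda>k. G ^ k))"
    using G by (intro range_inj_infinite injI) (simp add: power_inject_exp)
  ultimately have "infinite {n. dist_int (real a ^ n * digit_sum a w - xo) * dist_int (real b ^ n * digit_sum b w' - yo)
                         < exp (- real n * t)}" using finite_subset by blast
  then show ?thesis unfolding Mc_def A.attractor_eq B.attractor_eq using w(1) w'(1) by auto
qed

end

text \<open>The length condition keeps the windows disjoint, so the window containing a position is
  found from the largest power of \<open>G\<close> not exceeding that position.\<close>

lemma window_digits_exist:
  fixes G :: nat and m :: "nat \<Rightarrow> nat"
  assumes G: "G \<ge> 2" and m: "\<And>k. G ^ k + m k \<le> G ^ Suc k" and e: "e \<in> UNIV \<rightarrow> \<Lambda>"
  obtains z where "z \<in> UNIV \<rightarrow> \<Lambda>" "\<And>k i. i < m k \<Longrightarrow> z (G ^ k + i) = e i"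
proof
  \<comment> \<open>For \<open>n = 0\<close> no power of \<open>G\<close> qualifies and
    \<open>GREATEST\<close> is unspecified, but \<open>z 0\<close> is still a letter of
    \<open>e\<close>, and the windows start at position 1.\<close>
  define z where "z n = e (n - G ^ (GREATEST k. G ^ k \<le> n))" for n
  show "z \<in> UNIV \<rightarrow> \<Lambda>" using e by (auto simp: z_def)
  show "z (G ^ k + i) = e i" if "i < m k" for k i
  proof -
    have "(GREATEST j. G ^ j \<le> G ^ k + i) = k"
    proof (rule Greatest_equality)
      fix j assume "G ^ j \<le> G ^ k + i"
      then have "G ^ j < G ^ Suc k" using m[of k] that by linarith
      then have "j < Suc k" using G by (subst (asm) power_strict_increasing_iff) auto
      then show "j \<le> k" by simp
    qed simp
    then show ?thesis by (simp add: z_def)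
  qed
qed

context product_digits
begin

text \<open>The logarithm of the mass of a ball of radius \<open>exp (- \<rho>)\<close> is about
  minus \<open>(\<delta>\<^sub>1 + \<delta>\<^sub>2) * \<rho>\<close>, corrected by the forced
  digits visible at that scale. \<open>\<theta>\<close> bounds this correction relative to the
  scale, where \<open>r\<close> stands for \<open>\<rho>\<close> divided by the largest power of
  \<open>G\<close> below it.\<close>

lemma hausdorff_measure_Mc_nonzero:
  assumes UV: "U \<ge> 0" "V \<ge> 0" "U + V = t"
    and \<theta>: "\<And>r. r \<ge> 0 \<Longrightarrow> \<delta>\<^sub>1 * min U (max 0 (r - La)) + \<delta>\<^sub>2 * min V (max 0 (r - Lb)) \<le> \<theta> * r"
    and s: "0 \<le> s" "s < \<delta>\<^sub>1 + \<delta>\<^sub>2 - \<theta>"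
  shows "hausdorff_measure s M \<noteq> 0"
proof -
  \<comment> \<open>Stopping halfway below the critical exponent leaves the margin
    \<open>\<epsilon>\<close> for the windows before the current one.\<close>
  define s' where "s' = (s + (\<delta>\<^sub>1 + \<delta>\<^sub>2 - \<theta>)) / 2"
  define \<epsilon> where "\<epsilon> = \<delta>\<^sub>1 + \<delta>\<^sub>2 - \<theta> - s'"
  have s': "s' > 0" "s \<le> s'" "\<epsilon> > 0" using s by (auto simp: s'_def \<epsilon>_def)
  note pos = A.sim_dim_pos B.sim_dim_pos A.ln_base_ge_1 B.ln_base_ge_1
  define Cst where "Cst = \<delta>\<^sub>1 * (U + La) + \<delta>\<^sub>2 * (V + Lb)"
  define C' where "C' = \<delta>\<^sub>1 * La + \<delta>\<^sub>2 * Lb"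
  have C': "C' \<ge> 0" using pos by (simp add: C'_def)
  have \<theta>0: "\<theta> \<ge> 0"
  proof -
    have "0 \<le> \<delta>\<^sub>1 * min U (max 0 (1 - La)) + \<delta>\<^sub>2 * min V (max 0 (1 - Lb))" using pos UV by simp
    then show ?thesis using \<theta>[of 1] by linarith
  qed
  \<comment> \<open>\<open>U + 2\<close> and \<open>V + 2\<close> keep consecutive windows disjoint;
    \<open>Cst / \<epsilon>\<close> brings the geometric sum of the earlier windows down to the
    share \<open>\<epsilon>\<close>.\<close>
  obtain G :: nat where G0: "real G \<ge> U + V + 2 + Cst / \<epsilon>" using real_arch_simple by blast
  have "Cst \<ge> 0" using pos UV by (simp add: Cst_def)
  then have "Cst / \<epsilon> \<ge> 0" using s' by simp
  then have GUV: "real G \<ge> U + 2" "real G \<ge> V + 2" "real G - 1 \<ge> Cst / \<epsilon>" "real G \<ge> 2"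
    using UV G0 by auto
  then have G: "G \<ge> 2" by simp
  have GC: "Cst / (real G - 1) \<le> \<epsilon>" using GUV s' by (simp add: field_simps)
  define m where "m = (\<lambda>k. nat \<lfloor>real G ^ k * U / La\<rfloor> + 1)"
  define l where "l = (\<lambda>k. nat \<lfloor>real G ^ k * V / Lb\<rfloor> + 1)"
  have win: "G ^ k + (nat \<lfloor>real G ^ k * W / L\<rfloor> + 1) \<le> G ^ Suc k"
    if "W \<ge> 0" "L \<ge> 1" "real G \<ge> W + 2" for k W L
  proof -
    have G1: "1 \<le> real G ^ k" using GUV by (intro one_le_power) auto
    have "real (nat \<lfloor>real G ^ k * W / L\<rfloor>) \<le> real G ^ k * W / L" using that by (intro of_nat_floor) simp
    also have "\<dots> \<le> real G ^ k * W" using that using divide_left_mono[of 1 L "real G ^ k * W"] by simp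
    finally have "real (G ^ k + (nat \<lfloor>real G ^ k * W / L\<rfloor> + 1)) \<le> real G ^ k * (W + 2)"
      using G1 by (simp add: algebra_simps)
    also have "\<dots> \<le> real G ^ k * real G" using that by (intro mult_left_mono) auto
    finally have "real (G ^ k + (nat \<lfloor>real G ^ k * W / L\<rfloor> + 1)) \<le> real (G ^ Suc k)"
      by (simp add: mult.commute)
    then show ?thesis by (simp only: of_nat_le_iff)
  qed
  \<comment> \<open>The extra digit \<open>+ 1\<close> makes this strict, as the strict inequality
    in \<open>Mc\<close> demands.\<close>
  have up: "L * real (nat \<lfloor>real G ^ k * W / L\<rfloor> + 1) > real G ^ k * W" if "L \<ge> 1" for k W L
  proof -
    have "real G ^ k * W / L < real (nat \<lfloor>real G ^ k * W / L\<rfloor> + 1)" by linarith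
    then show ?thesis using that by (simp add: field_simps)
  qed
  obtain e where e: "e \<in> UNIV \<rightarrow> \<Lambda>a" "xo = digit_sum a e" using xo unfolding A.attractor_eq by blast
  obtain e' where e': "e' \<in> UNIV \<rightarrow> \<Lambda>b" "yo = digit_sum b e'" using yo unfolding B.attractor_eq by blast
  obtain z where z: "z \<in> UNIV \<rightarrow> \<Lambda>a" "\<And>k i. i < m k \<Longrightarrow> z (G ^ k + i) = e i"
    using window_digits_exist[OF G _ e(1), of m] win[of U La] UV pos GUV unfolding m_def by blast
  obtain z' where z': "z' \<in> UNIV \<rightarrow> \<Lambda>b" "\<And>k i. i < l k \<Longrightarrow> z' (G ^ k + i) = e' i"
    using window_digits_exist[OF G _ e'(1), of l] win[of V Lb] UV pos GUV unfolding l_def by blast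
  define F where "F = (\<Union>k. {G ^ k..<G ^ k + m k})"
  define F' where "F' = (\<Union>k. {G ^ k..<G ^ k + l k})"
  define P where "P = A.forced_measure F z"
  define Q where "Q = B.forced_measure F' z'"
  interpret P: prob_space P unfolding P_def by (rule A.prob_space_forced_measure)
  interpret Q: prob_space Q unfolding Q_def by (rule B.prob_space_forced_measure)
  interpret PQ: pair_prob_space P Q ..
  define f where "f = (\<lambda>(w, w'). (digit_sum a w, digit_sum b w'))"
  show ?thesis
  \<comment> \<open>25 = 5 * 5 counts the pairs of codes near a ball; one factor
    \<open>exp C'\<close> pays for rounding the two levels, the other for rounding the current
    windows.\<close>
  proof (rule mass_distribution_principle[where f = f and P = "P \<Otimes>\<^sub>M Q" and s' = s' and C = "25 * exp (2 * C')"])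
    show "prob_space (P \<Otimes>\<^sub>M Q)" by (rule PQ.prob_space_axioms)
    show "f \<omega> \<in> M" if "\<omega> \<in> space (P \<Otimes>\<^sub>M Q)" for \<omega>
    proof -
      obtain w w' where [simp]: "\<omega> = (w, w')" by (cases \<omega>)
      have w: "w \<in> space P" "w' \<in> space Q" using that by (auto simp: space_pair_measure)
      have "w (G ^ k + i) = e i" if "i < m k" for k i
      proof -
        have "G ^ k + i \<in> F" using that by (auto simp: F_def intro!: exI[of _ k])
        then show ?thesis using w(1) z(2)[OF that] by (auto simp: P_def A.space_forced_measure dest: spec[of _ "G ^ k + i"])
      qed
      moreover have "w' (G ^ k + i) = e' i" if "i < l k" for k i
      proof -
        have "G ^ k + i \<in> F'" using that by (auto simp: F'_def intro!: exI[of _ k])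
        then show ?thesis using w(2) z'(2)[OF that] by (auto simp: Q_def B.space_forced_measure dest: spec[of _ "G ^ k + i"])
      qed
      moreover have "La * real (m k) + Lb * real (l k) > real (G ^ k) * t" for k
        using add_strict_mono[OF up[of La k U] up[of Lb k V]] pos UV
        by (simp add: m_def l_def flip: distrib_left)
      ultimately have "(digit_sum a w, digit_sum b w') \<in> M"
        using A.space_forced_measure_digits[OF z(1)] B.space_forced_measure_digits[OF z'(1)] w
        unfolding P_def Q_def by (intro forced_windows_mem_Mc[OF e e' _ _ _ _ G, of _ m _ l]) auto
      then show ?thesis by (simp add: f_def)
    qed
    fix S :: "(real \<times> real) set" and r :: real
    assume S: "bounded S" "diameter S \<le> r" and r: "0 < r" "r \<le> 1"
    show "\<exists>A\<in>sets (P \<Otimes>\<^sub>M Q). {\<omega> \<in> space (P \<Otimes>\<^sub>M Q). f \<omega> \<in> S} \<subseteq> A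
        \<and> emeasure (P \<Otimes>\<^sub>M Q) A \<le> ennreal (25 * exp (2 * C') * r powr s')"
    proof (cases "{\<omega> \<in> space (P \<Otimes>\<^sub>M Q). f \<omega> \<in> S} = {}")
      case True then show ?thesis unfolding True by (intro bexI[of _ "{}"]) auto
    next
      case False
      then obtain w0 w0' where w0: "w0 \<in> space P" "w0' \<in> space Q" "(digit_sum a w0, digit_sum b w0') \<in> S"
        by (auto simp: space_pair_measure f_def)
      define \<rho> where "\<rho> = - ln r"
      have \<rho>: "\<rho> \<ge> 0" using r by (simp add: \<rho>_def)
      define p where "p = nat \<lfloor>\<rho> / La\<rfloor>"
      define q where "q = nat \<lfloor>\<rho> / Lb\<rfloor>"
      define fa where "fa = real (card ({..<p} \<inter> F))"
      define fb where "fb = real (card ({..<q} \<inter> F'))"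
      obtain X where X: "X \<in> sets P" "{w \<in> space P. \<bar>digit_sum a w - digit_sum a w0\<bar> \<le> r} \<subseteq> X"
        "emeasure P X \<le> ennreal (5 * exp (\<delta>\<^sub>1 * (La + ln r + La * fa)))"
        using A.forced_measure_ball[OF z(1) w0(1)[unfolded P_def] r, of p]
        unfolding P_def fa_def p_def \<rho>_def by blast
      obtain Y where Y: "Y \<in> sets Q" "{w \<in> space Q. \<bar>digit_sum b w - digit_sum b w0'\<bar> \<le> r} \<subseteq> Y"
        "emeasure Q Y \<le> ennreal (5 * exp (\<delta>\<^sub>2 * (Lb + ln r + Lb * fb)))"
        using B.forced_measure_ball[OF z'(1) w0(2)[unfolded Q_def] r, of q]
        unfolding Q_def fb_def q_def \<rho>_def by blast
      have "{\<omega> \<in> space (P \<Otimes>\<^sub>M Q). f \<omega> \<in> S} \<subseteq> X \<times> Y"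
      proof
        fix \<omega> assume \<omega>: "\<omega> \<in> {\<omega> \<in> space (P \<Otimes>\<^sub>M Q). f \<omega> \<in> S}"
        then obtain w w' where [simp]: "\<omega> = (w, w')" and w: "w \<in> space P" "w' \<in> space Q"
          "(digit_sum a w, digit_sum b w') \<in> S" by (cases \<omega>) (auto simp: space_pair_measure f_def)
        have d: "dist (digit_sum a w, digit_sum b w') (digit_sum a w0, digit_sum b w0') \<le> r"
          using diameter_bounded_bound[OF S(1) w(3) w0(3)] S(2) by simp
        have "\<bar>digit_sum a w - digit_sum a w0\<bar> \<le> r" "\<bar>digit_sum b w' - digit_sum b w0'\<bar> \<le> r"
          using dist_fst_le[of "(digit_sum a w, digit_sum b w')" "(digit_sum a w0, digit_sum b w0')"]
            dist_snd_le[of "(digit_sum a w, digit_sum b w')" "(digit_sum a w0, digit_sum b w0')"] d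
          by (auto simp: dist_real_def)
        then show "\<omega> \<in> X \<times> Y" using X(2) Y(2) w by auto
      qed
      moreover have "emeasure (P \<Otimes>\<^sub>M Q) (X \<times> Y) \<le> ennreal (25 * exp (2 * C') * r powr s')"
      proof -
        have key: "\<delta>\<^sub>1 * (La * fa) + \<delta>\<^sub>2 * (Lb * fb) \<le> (\<theta> + \<epsilon>) * \<rho> + C'"
        proof (cases "\<rho> < 1")
          \<comment> \<open>No power of \<open>G\<close> lies below such a \<open>\<rho>\<close>,
            but no digit is visible either, because both logarithms are at least 1.\<close>
          case True
          then have "\<rho> / La < 1" "\<rho> / Lb < 1" using pos by (auto simp: divide_less_eq)
          then have "p = 0" "q = 0" unfolding p_def q_def by linarith+
          then have "fa = 0" "fb = 0" by (auto simp: fa_def fb_def)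
          then show ?thesis using \<theta>0 s' \<rho> C' by simp
        next
          case False
          \<comment> \<open>Window \<open>K\<close> costs at most \<open>\<theta> * \<rho>\<close>, all earlier ones together at most \<open>\<epsilon> * \<rho>\<close> because
            \<open>G\<close> is large, and later ones are invisible at scale \<open>exp (- \<rho>)\<close>.\<close>
          then have "1 \<le> nat \<lfloor>\<rho>\<rfloor>" by linarith
          then obtain K where K0: "G ^ K \<le> nat \<lfloor>\<rho>\<rfloor>" "nat \<lfloor>\<rho>\<rfloor> < G ^ (K + 1)"
            using ex_power_ivl1[OF G] by blast
          have K: "real G ^ K \<le> \<rho>" "\<rho> < real G ^ Suc K"
          proof -
            have "real (G ^ K) \<le> \<rho>" using K0(1) \<rho> by linarith
            then show "real G ^ K \<le> \<rho>" by simp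
            have "\<rho> < real (G ^ Suc K)" using K0(2) unfolding Suc_eq_plus1 by linarith
            then show "\<rho> < real G ^ Suc K" by simp
          qed
          define N where "N = real G ^ K"
          have N: "N > 0" using GUV by (simp add: N_def)
          have a: "La * fa \<le> (U + La) * (N / (real G - 1)) + min (N * U) (max 0 (\<rho> - N * La)) + La"
            unfolding fa_def F_def N_def using pos UV
            by (intro forced_window_count[OF _ _ G K p_def m_def]) auto
          have b: "Lb * fb \<le> (V + Lb) * (N / (real G - 1)) + min (N * V) (max 0 (\<rho> - N * Lb)) + Lb"
            unfolding fb_def F'_def N_def using pos UV
            by (intro forced_window_count[OF _ _ G K q_def l_def]) auto
          \<comment> \<open>Dividing by \<open>N\<close> passes to the relative scale
            \<open>\<rho> / N\<close>, at which the hypothesis on \<open>\<theta>\<close>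
            applies.\<close>
          have sc: "min (N * W) (max 0 (\<rho> - N * L)) = N * min W (max 0 (\<rho> / N - L))" for W L
            using N by (simp add: min_mult_distrib_left max_mult_distrib_left right_diff_distrib)
          have "\<delta>\<^sub>1 * (La * fa) + \<delta>\<^sub>2 * (Lb * fb)
              \<le> \<delta>\<^sub>1 * ((U + La) * (N / (real G - 1)) + N * min U (max 0 (\<rho> / N - La)) + La)
               + \<delta>\<^sub>2 * ((V + Lb) * (N / (real G - 1)) + N * min V (max 0 (\<rho> / N - Lb)) + Lb)"
            using a b pos unfolding sc by (intro add_mono mult_left_mono) auto
          also have "\<dots> = N * (Cst / (real G - 1))
              + N * (\<delta>\<^sub>1 * min U (max 0 (\<rho> / N - La)) + \<delta>\<^sub>2 * min V (max 0 (\<rho> / N - Lb))) + C'"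
            by (simp add: Cst_def C'_def algebra_simps add_divide_distrib)
          also have "\<dots> \<le> N * \<epsilon> + N * (\<theta> * (\<rho> / N)) + C'"
            using \<rho> N GC by (intro add_mono mult_left_mono \<theta>) auto
          also have "\<dots> \<le> \<rho> * \<epsilon> + \<theta> * \<rho> + C'" using N K(1) s' by (simp add: N_def)
          finally show ?thesis by (simp add: algebra_simps)
        qed
        have "emeasure (P \<Otimes>\<^sub>M Q) (X \<times> Y) = emeasure P X * emeasure Q Y"
          by (rule Q.emeasure_pair_measure_Times[OF X(1) Y(1)])
        also have "\<dots> \<le> ennreal (5 * exp (\<delta>\<^sub>1 * (La + ln r + La * fa))) * ennreal (5 * exp (\<delta>\<^sub>2 * (Lb + ln r + Lb * fb)))"
          by (intro mult_mono X Y) auto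
        also have "\<dots> = ennreal (25 * exp (\<delta>\<^sub>1 * (La + ln r + La * fa) + \<delta>\<^sub>2 * (Lb + ln r + Lb * fb)))"
          by (simp add: exp_add flip: ennreal_mult)
        also have "\<dots> \<le> ennreal (25 * exp (2 * C') * r powr s')"
        proof (intro ennreal_leI)
          have "\<delta>\<^sub>1 * (La + ln r + La * fa) + \<delta>\<^sub>2 * (Lb + ln r + Lb * fb)
              = C' - (\<delta>\<^sub>1 + \<delta>\<^sub>2) * \<rho> + (\<delta>\<^sub>1 * (La * fa) + \<delta>\<^sub>2 * (Lb * fb))"
            by (simp add: C'_def \<rho>_def algebra_simps)
          also have "\<dots> \<le> 2 * C' + s' * ln r" using key by (simp add: \<epsilon>_def \<rho>_def algebra_simps)
          finally have "exp (\<delta>\<^sub>1 * (La + ln r + La * fa) + \<delta>\<^sub>2 * (Lb + ln r + Lb * fb)) \<le> exp (2 * C' + s' * ln r)"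
            by simp
          then show "25 * exp (\<delta>\<^sub>1 * (La + ln r + La * fa) + \<delta>\<^sub>2 * (Lb + ln r + Lb * fb)) \<le> 25 * exp (2 * C') * r powr s'"
            using r by (simp add: powr_def exp_add)
        qed
        finally show ?thesis .
      qed
      moreover have "X \<times> Y \<in> sets (P \<Otimes>\<^sub>M Q)" using X(1) Y(1) by simp
      ultimately show ?thesis by blast
    qed
  qed (use s s' in auto)
qed

end

section \<open>Upper bound\<close>

lemma sum_UN_le:
  fixes f :: "'a \<Rightarrow> real"
  assumes "finite I" "\<And>i. i \<in> I \<Longrightarrow> finite (A i)" "\<And>x. f x \<ge> 0"
  shows "sum f (\<Union>i\<in>I. A i) \<le> (\<Sum>i\<in>I. sum f (A i))"
  using assms(1,2)
proof (induction I rule: finite_induct)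
  case (insert i I)
  have "sum f (\<Union>i\<in>insert i I. A i) = sum f (A i) + sum f (\<Union>i\<in>I. A i) - sum f (A i \<inter> (\<Union>i\<in>I. A i))"
    using insert by (simp add: sum_Un)
  also have "\<dots> \<le> sum f (A i) + sum f (\<Union>i\<in>I. A i)" using assms(3) by (simp add: sum_nonneg)
  finally show ?case using insert by simp
qed simp

section \<open>Counting the cells of points whose orbit is near the target at a given time\<close>

context restricted_digits
begin

lemma prefix_codes_finite_card:
  "finite (prefix_code a p ` (UNIV \<rightarrow> \<Lambda>)) \<and> card (prefix_code a p ` (UNIV \<rightarrow> \<Lambda>)) \<le> card \<Lambda> ^ p"
proof (induction p)
  case 0
  have sub: "prefix_code a 0 ` (UNIV \<rightarrow> \<Lambda>) \<subseteq> {0}" by auto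
  show ?case using card_mono[OF _ sub] finite_subset[OF sub] by simp
next
  case (Suc p)
  let ?S = "prefix_code a p ` (UNIV \<rightarrow> \<Lambda>) \<times> \<Lambda>"
  have fin: "finite ?S" using Suc finite_digits by simp
  have sub: "prefix_code a (Suc p) ` (UNIV \<rightarrow> \<Lambda>) \<subseteq> (\<lambda>(c, k). a * c + k) ` ?S"
  proof (intro subsetI, elim imageE)
    fix x and w :: "nat \<Rightarrow> nat" assume "x = prefix_code a (Suc p) w" "w \<in> UNIV \<rightarrow> \<Lambda>"
    then show "x \<in> (\<lambda>(c, k). a * c + k) ` ?S"
      by (intro image_eqI[of _ _ "(prefix_code a p w, w p)"]) auto
  qed
  have "card (prefix_code a (Suc p) ` (UNIV \<rightarrow> \<Lambda>)) \<le> card ((\<lambda>(c, k). a * c + k) ` ?S)"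
    using fin sub by (intro card_mono) auto
  also have "\<dots> \<le> card ?S" using fin by (rule card_image_le)
  also have "\<dots> \<le> card \<Lambda> ^ Suc p" using Suc by (simp add: card_cartesian_product mult.commute)
  finally show ?case using finite_subset[OF sub] fin by simp
qed

lemma attractor_bounds: "x \<in> attractor a \<Lambda> \<Longrightarrow> 0 \<le> x \<and> x \<le> 1"
  unfolding attractor_eq using digit_sum_shift_bounds[where p = 0] by fastforce

text \<open>The first \<open>n\<close> digits are free, the next \<open>m\<close> are pinned down by
  \<open>xo\<close>, the rest are free again. 25 is 5 * 5: five integers \<open>i\<close> by which
  the shifted point may differ from \<open>xo\<close>, and five labels for each of them after
  rounding.\<close>

lemma near_codes_finite_card:
  assumes xo: "xo \<in> attractor a \<Lambda>" and p: "n + m \<le> p" and \<epsilon>: "\<epsilon> \<le> 1 / real a ^ m"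
  defines "W \<equiv> {w \<in> UNIV \<rightarrow> \<Lambda>. dist_int (real a ^ n * digit_sum a w - xo) \<le> \<epsilon>}"
  shows "finite (prefix_code a p ` W)" "card (prefix_code a p ` W) \<le> 25 * card \<Lambda> ^ (p - m)"
proof -
  let ?C = "\<lambda>k. prefix_code a k ` (UNIV \<rightarrow> \<Lambda>)"
  define y where "y i = \<lceil>real a ^ m * (xo + of_int i)\<rceil>" for i :: int
  define T where "T = (\<Union>i\<in>{-2..2}. nat ` {y i - 2..y i + 2})"
  define r where "r = p - n - m"
  have am: "real a ^ m \<ge> 1" using base by (intro one_le_power) auto
  have cT: "finite T" "card T \<le> 25"
  proof -
    show "finite T" by (simp add: T_def)
    have "card T \<le> (\<Sum>i\<in>{-2..2}. card (nat ` {y i - 2..y i + 2}))"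
      unfolding T_def by (rule card_UN_le) simp
    also have "\<dots> \<le> (\<Sum>i\<in>{-2..2::int}. 5)"
      by (intro sum_mono order_trans[OF card_image_le]) auto
    finally show "card T \<le> 25" by simp
  qed
  let ?g = "\<lambda>(u, c, v). u * a ^ (m + r) + (c * a ^ r + v)"
  have sub: "prefix_code a p ` W \<subseteq> ?g ` (?C n \<times> T \<times> ?C r)"
  proof (intro subsetI, elim imageE)
    fix c w assume c: "c = prefix_code a p w" and "w \<in> W"
    then have w: "w \<in> UNIV \<rightarrow> \<Lambda>" "dist_int (real a ^ n * digit_sum a w - xo) \<le> \<epsilon>" by (auto simp: W_def)
    define v where "v = (\<lambda>i. w (n + i))"
    have v: "v \<in> UNIV \<rightarrow> \<Lambda>" using w(1) by (auto simp: v_def)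
    obtain k where k: "dist_int (real a ^ n * digit_sum a w - xo) = \<bar>real a ^ n * digit_sum a w - xo - of_int k\<bar>"
      using dist_int_attained by blast
    define i where "i = k - int (prefix_code a n w)"
    have "real a ^ n * digit_sum a w = real (prefix_code a n w) + digit_sum a v"
      using power_mult_digit_sum_digits[OF w(1), of n] by (simp add: v_def)
    then have close: "\<bar>digit_sum a v - xo - of_int i\<bar> \<le> 1 / real a ^ m"
      using w(2) k \<epsilon> by (simp add: i_def algebra_simps)
    have "1 / real a ^ m \<le> 1" using am by (subst divide_le_eq_1_pos) linarith+
    then have "\<bar>digit_sum a v - xo - of_int i\<bar> \<le> 1" using close by linarith
    moreover have "0 \<le> digit_sum a v" "digit_sum a v \<le> 1" "0 \<le> xo" "xo \<le> 1"
      using digit_sum_shift_bounds[OF v, of 0] attractor_bounds[OF xo] by auto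
    ultimately have "\<bar>of_int i :: real\<bar> \<le> 2" by linarith
    then have i2: "i \<in> {-2..2}" by auto
    have "real a ^ m * \<bar>digit_sum a v - xo - of_int i\<bar> \<le> real a ^ m * (1 / real a ^ m)"
      using close by (intro mult_left_mono) auto
    then have "\<bar>real a ^ m * (digit_sum a v - xo - of_int i)\<bar> \<le> 1"
      using base by (simp add: abs_mult)
    then have "\<bar>real a ^ m * digit_sum a v - real a ^ m * (xo + of_int i)\<bar> \<le> 1"
      by (simp add: algebra_simps)
    then have "\<bar>real (prefix_code a m v) + digit_sum a (\<lambda>i. v (m + i)) - real a ^ m * (xo + of_int i)\<bar> \<le> 1"
      using power_mult_digit_sum_digits[OF v, of m] by simp
    then have "int (prefix_code a m v) \<in> {y i - 2..y i + 2}"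
      using digit_sum_shift_bounds[OF v, of m] unfolding y_def by auto linarith+
    then have T: "prefix_code a m v \<in> T" unfolding T_def using i2
      by (intro UN_I[of i] image_eqI[of _ _ "int (prefix_code a m v)"]) auto
    have "p = n + (m + r)" using p by (simp add: r_def)
    then have "c = ?g (prefix_code a n w, prefix_code a m v, prefix_code a r (\<lambda>i. v (m + i)))"
      unfolding c by (simp add: prefix_code_add v_def)
    moreover have "(\<lambda>i. v (m + i)) \<in> UNIV \<rightarrow> \<Lambda>" using v by auto
    ultimately show "c \<in> ?g ` (?C n \<times> T \<times> ?C r)" using w(1) T by blast
  qed
  have fin: "finite (?C n \<times> T \<times> ?C r)" using cT prefix_codes_finite_card by blast
  show "finite (prefix_code a p ` W)" using finite_subset[OF sub] fin by blast
  have "card (prefix_code a p ` W) \<le> card (?g ` (?C n \<times> T \<times> ?C r))"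
    using fin sub by (intro card_mono) auto
  also have "\<dots> \<le> card (?C n \<times> T \<times> ?C r)" using fin by (rule card_image_le)
  also have "\<dots> = card (?C n) * (card T * card (?C r))" by (simp add: card_cartesian_product)
  also have "\<dots> \<le> card \<Lambda> ^ n * (25 * card \<Lambda> ^ r)"
    using cT prefix_codes_finite_card by (intro mult_le_mono) auto
  also have "\<dots> = 25 * card \<Lambda> ^ (n + r)" by (simp add: power_add)
  also have "n + r = p - m" using p by (simp add: r_def)
  finally show "card (prefix_code a p ` W) \<le> 25 * card \<Lambda> ^ (p - m)" .
qed

text \<open>The level is rounded up, so that the labelled cells have length at most
  \<open>exp (- \<rho>)\<close>.\<close>

definition near_codes :: "real \<Rightarrow> nat \<Rightarrow> real \<Rightarrow> real \<Rightarrow> nat set" where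
  "near_codes xo n U \<rho> = prefix_code a (nat \<lceil>\<rho> / ln (real a)\<rceil>) `
    {w \<in> UNIV \<rightarrow> \<Lambda>. dist_int (real a ^ n * digit_sum a w - xo) \<le> exp (- (real n * U))}"

text \<open>The hypothesis on \<open>\<rho>\<close> says that the cells resolve the first
  \<open>n\<close> digits and the whole pinned block, so the full saving \<open>n * U\<close> is
  realised. Rounding the level up and the block length down costs the two extra
  \<open>ln (real a)\<close>.\<close>

lemma near_codes:
  assumes xo: "xo \<in> attractor a \<Lambda>" and U: "U \<ge> 0" and \<rho>: "\<rho> \<ge> real n * (ln (real a) + U)"
  shows "finite (near_codes xo n U \<rho>)"
    and "real (card (near_codes xo n U \<rho>)) \<le> 25 * exp (sim_dim * (\<rho> - real n * U + 2 * ln (real a)))"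
proof -
  let ?L = "ln (real a)"
  define p where "p = nat \<lceil>\<rho> / ?L\<rceil>"
  define m where "m = nat \<lfloor>real n * U / ?L\<rfloor>"
  have L: "?L \<ge> 1" by (rule ln_base_ge_1)
  have "real m \<le> real n * U / ?L" unfolding m_def using L U by (intro of_nat_floor) simp
  then have mL: "?L * real m \<le> real n * U" using L by (simp add: field_simps)
  have "real n * U / ?L < real m + 1" unfolding m_def by linarith
  then have mL': "real n * U < ?L * (real m + 1)" using L by (simp add: field_simps)
  have "\<rho> \<ge> 0" using \<rho> L U by (smt (verit) mult_nonneg_nonneg of_nat_0_le_iff)
  then have "\<rho> / ?L \<ge> 0" using L by simp
  then have p1: "\<rho> / ?L \<le> real p" "real p < \<rho> / ?L + 1" unfolding p_def by linarith+
  then have p: "\<rho> \<le> ?L * real p" "?L * real p < \<rho> + ?L" using L by (simp_all add: field_simps)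
  have "?L * real (n + m) \<le> ?L * real p" using \<rho> mL p(1) by (simp add: algebra_simps)
  then have nm: "n + m \<le> p" using L by (simp add: mult_le_cancel_left_pos)
  have "exp (- (real n * U)) \<le> exp (- (?L * real m))" using mL by simp
  also have "\<dots> = 1 / real a ^ m" by (simp add: base_power exp_minus inverse_eq_divide)
  finally have e: "exp (- (real n * U)) \<le> 1 / real a ^ m" .
  show "finite (near_codes xo n U \<rho>)"
    unfolding near_codes_def using near_codes_finite_card(1)[OF xo nm e] by (simp add: p_def)
  have "real (card (near_codes xo n U \<rho>)) \<le> real (25 * card \<Lambda> ^ (p - m))"
    unfolding near_codes_def using near_codes_finite_card(2)[OF xo nm e]
    by (simp add: p_def of_nat_le_iff del: of_nat_mult of_nat_power)
  also have "\<dots> = 25 * exp (sim_dim * (?L * real (p - m)))" by (simp add: card_digits_power mult.assoc)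
  also have "\<dots> \<le> 25 * exp (sim_dim * (\<rho> - real n * U + 2 * ?L))"
  proof -
    have "?L * real (p - m) = ?L * real p - ?L * real m" using nm by (simp add: of_nat_diff algebra_simps)
    also have "\<dots> \<le> \<rho> - real n * U + 2 * ?L" using p(2) mL' by (simp add: algebra_simps)
    finally show ?thesis using sim_dim_pos by simp
  qed
  finally show "real (card (near_codes xo n U \<rho>)) \<le> 25 * exp (sim_dim * (\<rho> - real n * U + 2 * ?L))" .
qed

lemma digit_sum_cell:
  assumes "w \<in> UNIV \<rightarrow> \<Lambda>"
  shows "digit_sum a w \<in> {real (prefix_code a p w) / real a ^ p..(real (prefix_code a p w) + 1) / real a ^ p}"
proof -
  have "real a ^ p > 0" using base by simp
  then show ?thesis
    using power_mult_digit_sum_digits[OF assms, of p] digit_sum_shift_bounds[OF assms, of p]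
    by (simp add: field_simps)
qed

lemma cell_length:
  assumes "x \<in> {c / real a ^ p..(c + 1) / real a ^ p}" "y \<in> {c / real a ^ p..(c + 1) / real a ^ p}"
    and p: "p = nat \<lceil>\<rho> / ln (real a)\<rceil>"
  shows "\<bar>x - y\<bar> \<le> exp (- \<rho>)"
proof -
  have "\<rho> / ln (real a) \<le> real p" unfolding p by linarith
  then have "\<rho> \<le> ln (real a) * real p" using ln_base_ge_1 by (simp add: field_simps)
  then have "exp (- (ln (real a) * real p)) \<le> exp (- \<rho>)" by simp
  then have "1 / real a ^ p \<le> exp (- \<rho>)" by (simp add: base_power exp_minus inverse_eq_divide)
  then show ?thesis using assms(1,2) by (auto simp: add_divide_distrib abs_le_iff)
qed

end

text \<open>For maximal \<open>j\<close>, \<open>X\<close> exceeds the next threshold, which forces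
  \<open>Y\<close> to be small. The exponents add up to \<open>s * (1 - 1 / J)\<close>: one grid
  step is the price for having finitely many pairs.\<close>

lemma split_product_bound:
  fixes X Y s :: real
  assumes X: "0 \<le> X" "X \<le> 1" and Y: "0 \<le> Y" "Y \<le> 1" and XY: "X * Y < exp (- s)" and J: "J \<ge> (1::nat)"
  shows "\<exists>j<J. X \<le> exp (- (s * (real j / real J))) \<and> Y \<le> exp (- (s * ((real J - 1 - real j) / real J)))"
proof -
  \<comment> \<open>The bound \<open>j < J\<close> keeps \<open>S\<close> finite even when
    \<open>X = 0\<close>.\<close>
  define S where "S = {j. j < J \<and> X \<le> exp (- (s * (real j / real J)))}"
  have S: "finite S" "0 \<in> S" using X J by (auto simp: S_def)
  define j where "j = Max S"
  have "j \<in> S" unfolding j_def using S by (intro Max_in) auto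
  then have j: "j < J" "X \<le> exp (- (s * (real j / real J)))" unfolding S_def by auto
  have "Y \<le> exp (- (s * ((real J - 1 - real j) / real J)))"
  proof (cases "Suc j = J")
    \<comment> \<open>The last index has no next threshold, but there the exponent claimed for
      \<open>Y\<close> is 0.\<close>
    case True
    then have "real J - 1 - real j = 0" by auto
    then show ?thesis using Y by simp
  next
    case False
    then have "Suc j \<notin> S" using Max_ge[OF S(1), of "Suc j"] by (auto simp: j_def)
    then have "X > exp (- (s * (real (Suc j) / real J)))" using False j(1) by (auto simp: S_def)
    then have "exp (- (s * (real (Suc j) / real J))) * Y \<le> X * Y" using Y by (intro mult_right_mono) auto
    then have "exp (- (s * (real (Suc j) / real J))) * Y < exp (- s)" using XY by linarith
    then have "Y < exp (- s) / exp (- (s * (real (Suc j) / real J)))" by (simp add: field_simps)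
    also have "\<dots> = exp (- s + s * (real (Suc j) / real J))" by (simp flip: exp_diff)
    also have "- s + s * (real (Suc j) / real J) = - (s * ((real J - 1 - real j) / real J))"
      using J by (simp add: field_simps)
    finally show ?thesis by simp
  qed
  then show ?thesis using j by blast
qed

section \<open>Covers of the limsup set and the resulting dimension bounds\<close>

context product_digits
begin

text \<open>For each \<open>j\<close> the cells at time \<open>n\<close> cost at most a constant
  times \<open>exp (- \<kappa> j * n)\<close>, and \<open>key\<close> states
  \<open>\<kappa> j > 0\<close>; summing over finitely many \<open>j\<close> leaves a convergent
  series in \<open>n\<close>.\<close>

lemma hausdorff_measure_Mc_eq_0_discrete:
  fixes J :: nat
  assumes s: "s \<ge> 0" and J: "J \<ge> 1"
    and key: "\<And>j. j < J \<Longrightarrow> (\<delta>\<^sub>1 + \<delta>\<^sub>2 - s) * max (La + t * (real j / J)) (Lb + t * ((real J - 1 - real j) / J))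
      < \<delta>\<^sub>1 * (t * (real j / J)) + \<delta>\<^sub>2 * (t * ((real J - 1 - real j) / J))"
  shows "hausdorff_measure s M = 0"
proof -
  note pos = A.sim_dim_pos B.sim_dim_pos A.ln_base_ge_1 B.ln_base_ge_1
  define U where "U j = t * (real j / J)" for j :: nat
  define V where "V j = t * ((real J - 1 - real j) / J)" for j :: nat
  define R where "R j = max (La + U j) (Lb + V j)" for j
  define \<kappa> where "\<kappa> j = \<delta>\<^sub>1 * U j + \<delta>\<^sub>2 * V j - (\<delta>\<^sub>1 + \<delta>\<^sub>2 - s) * R j" for j
  have \<kappa>: "\<kappa> j > 0" if "j < J" for j using key[OF that] by (simp add: \<kappa>_def R_def U_def V_def)
  have U: "U j \<ge> 0" for j using t by (simp add: U_def)
  have V: "V j \<ge> 0" if "j < J" for j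
  proof -
    have "real j + 1 \<le> real J" using that by linarith
    then show ?thesis using t by (simp add: V_def)
  qed
  have R1: "R j \<ge> 1" for j using U[of j] pos by (simp add: R_def)
  define p where "p n j = nat \<lceil>real n * R j / La\<rceil>" for n j
  define q where "q n j = nat \<lceil>real n * R j / Lb\<rceil>" for n j
  define I where "I n j = A.near_codes xo n (U j) (real n * R j) \<times> B.near_codes yo n (V j) (real n * R j)" for n j
  define cell where "cell n j = (\<lambda>(c :: nat, c' :: nat). {real c / real a ^ p n j..(real c + 1) / real a ^ p n j}
      \<times> {real c' / real b ^ q n j..(real c' + 1) / real b ^ q n j})" for n j
  define \<U> where "\<U> n = (\<Union>j<J. cell n j ` I n j)" for n
  \<comment> \<open>625 = 25 * 25 and the exponential come from \<open>near_codes\<close> in both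
    coordinates, \<open>2 powr s\<close> from diameters being at most twice the side.\<close>
  define \<beta> where "\<beta> = 625 * exp (2 * (\<delta>\<^sub>1 * La + \<delta>\<^sub>2 * Lb)) * 2 powr s"
  have \<rho>: "real n * (La + U j) \<le> real n * R j" "real n * (Lb + V j) \<le> real n * R j" for n j
    by (auto simp: R_def intro!: mult_left_mono)
  have nearA: "finite (A.near_codes xo n (U j) (real n * R j))"
    "real (card (A.near_codes xo n (U j) (real n * R j))) \<le> 25 * exp (\<delta>\<^sub>1 * (real n * R j - real n * U j + 2 * La))"
    for n j using A.near_codes[OF xo U \<rho>(1)] by auto
  have nearB: "finite (B.near_codes yo n (V j) (real n * R j))"
    "real (card (B.near_codes yo n (V j) (real n * R j))) \<le> 25 * exp (\<delta>\<^sub>2 * (real n * R j - real n * V j + 2 * Lb))"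
    if "j < J" for n j using B.near_codes[OF yo V[OF that] \<rho>(2)] by auto
  have finI: "finite (I n j)" if "j < J" for n j using nearA nearB[OF that] by (simp add: I_def)
  have bdd: "bounded (cell n j i)" for n j i
    unfolding cell_def by (cases i) (auto intro: bounded_Times bounded_closed_interval)
  have diam: "diameter (cell n j i) \<le> 2 * exp (- (real n * R j))" for n j i
  proof (rule diameter_le)
    obtain c c' where i: "i = (c, c')" by (cases i)
    fix x y assume "x \<in> cell n j i" "y \<in> cell n j i"
    then have mem: "fst x \<in> {real c / real a ^ p n j..(real c + 1) / real a ^ p n j}"
      "fst y \<in> {real c / real a ^ p n j..(real c + 1) / real a ^ p n j}"
      "snd x \<in> {real c' / real b ^ q n j..(real c' + 1) / real b ^ q n j}"
      "snd y \<in> {real c' / real b ^ q n j..(real c' + 1) / real b ^ q n j}"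
      by (auto simp: cell_def i)
    have "norm (x - y) \<le> \<bar>fst x - fst y\<bar> + \<bar>snd x - snd y\<bar>"
      using norm_Pair_le[of "fst (x - y)" "snd (x - y)"] unfolding prod.collapse by simp
    then show "norm (x - y) \<le> 2 * exp (- (real n * R j))"
      using A.cell_length[OF mem(1,2) p_def] B.cell_length[OF mem(3,4) q_def] by linarith
  qed simp
  have sum_le: "(\<Sum>S\<in>\<U> n. diameter S powr s) \<le> (\<Sum>j<J. \<beta> * exp (- \<kappa> j) ^ n)" for n
  proof -
    have "(\<Sum>S\<in>\<U> n. diameter S powr s) \<le> (\<Sum>j<J. \<Sum>S\<in>cell n j ` I n j. diameter S powr s)"
      unfolding \<U>_def using finI by (intro sum_UN_le) auto
    also have "\<dots> \<le> (\<Sum>j<J. \<beta> * exp (- \<kappa> j) ^ n)"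
    proof (rule sum_mono)
      fix j assume "j \<in> {..<J}"
      then have j: "j < J" by simp
      let ?d = "2 * exp (- (real n * R j))"
      have "(\<Sum>S\<in>cell n j ` I n j. diameter S powr s) \<le> (\<Sum>S\<in>cell n j ` I n j. ?d powr s)"
        using diam bdd s by (intro sum_mono powr_mono2) (auto intro: diameter_ge_0)
      also have "\<dots> = real (card (cell n j ` I n j)) * ?d powr s" by simp
      also have "\<dots> \<le> real (card (I n j)) * ?d powr s"
        using card_image_le[OF finI[OF j]] by (intro mult_right_mono) auto
      also have "\<dots> = (real (card (A.near_codes xo n (U j) (real n * R j)))
          * real (card (B.near_codes yo n (V j) (real n * R j)))) * ?d powr s"
        by (simp add: I_def card_cartesian_product)
      also have "\<dots> \<le> ((25 * exp (\<delta>\<^sub>1 * (real n * R j - real n * U j + 2 * La)))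
          * (25 * exp (\<delta>\<^sub>2 * (real n * R j - real n * V j + 2 * Lb)))) * ?d powr s"
        using nearA nearB[OF j] by (intro mult_right_mono mult_mono) auto
      also have "?d powr s = 2 powr s * exp (- (real n * R j) * s)"
        by (simp add: powr_mult exp_powr_real)
      also have "((25 * exp (\<delta>\<^sub>1 * (real n * R j - real n * U j + 2 * La)))
          * (25 * exp (\<delta>\<^sub>2 * (real n * R j - real n * V j + 2 * Lb)))) * (2 powr s * exp (- (real n * R j) * s))
        = 625 * 2 powr s * exp (\<delta>\<^sub>1 * (real n * R j - real n * U j + 2 * La)
           + \<delta>\<^sub>2 * (real n * R j - real n * V j + 2 * Lb) + (- (real n * R j) * s))"
        by (simp only: exp_add mult_ac)
      also have "\<delta>\<^sub>1 * (real n * R j - real n * U j + 2 * La)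
           + \<delta>\<^sub>2 * (real n * R j - real n * V j + 2 * Lb) + (- (real n * R j) * s)
         = 2 * (\<delta>\<^sub>1 * La + \<delta>\<^sub>2 * Lb) + real n * (- \<kappa> j)"
        by (simp add: \<kappa>_def algebra_simps)
      also have "625 * 2 powr s * exp \<dots> = \<beta> * exp (- \<kappa> j) ^ n"
        by (simp only: \<beta>_def exp_add exp_of_nat_mult mult_ac)
      finally show "(\<Sum>S\<in>cell n j ` I n j. diameter S powr s) \<le> \<beta> * exp (- \<kappa> j) ^ n" .
    qed
    finally show ?thesis .
  qed
  have summ: "summable (\<lambda>n. \<Sum>j<J. \<beta> * exp (- \<kappa> j) ^ n)"
    using \<kappa> by (intro summable_sum summable_mult summable_geometric) auto
  have cov: "infinite {n. z \<in> \<Union>(\<U> n)}" if zM: "z \<in> M" for z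
  proof -
    obtain w w' where w: "w \<in> UNIV \<rightarrow> \<Lambda>a" "w' \<in> UNIV \<rightarrow> \<Lambda>b" and z: "z = (digit_sum a w, digit_sum b w')"
      and inf: "infinite {n. dist_int (real a ^ n * digit_sum a w - xo) * dist_int (real b ^ n * digit_sum b w' - yo)
                         < exp (- real n * t)}"
      using zM unfolding Mc_def A.attractor_eq B.attractor_eq by auto
    have "z \<in> \<Union>(\<U> n)" if n: "dist_int (real a ^ n * digit_sum a w - xo) * dist_int (real b ^ n * digit_sum b w' - yo)
                         < exp (- real n * t)" for n
    proof -
      let ?X = "dist_int (real a ^ n * digit_sum a w - xo)"
      let ?Y = "dist_int (real b ^ n * digit_sum b w' - yo)"
      have h: "0 \<le> ?X" "?X \<le> 1" "0 \<le> ?Y" "?Y \<le> 1"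
        using dist_int_bounds[of "real a ^ n * digit_sum a w - xo"]
          dist_int_bounds[of "real b ^ n * digit_sum b w' - yo"] by auto
      have "?X * ?Y < exp (- (real n * t))" using n by simp
      from split_product_bound[OF h this J] obtain j where j: "j < J"
        "?X \<le> exp (- (real n * t * (real j / real J)))"
        "?Y \<le> exp (- (real n * t * ((real J - 1 - real j) / real J)))" by blast
      have "prefix_code a (p n j) w \<in> A.near_codes xo n (U j) (real n * R j)"
        unfolding A.near_codes_def p_def U_def using j(2) w(1) by (intro imageI) (simp add: mult.assoc)
      moreover have "prefix_code b (q n j) w' \<in> B.near_codes yo n (V j) (real n * R j)"
        unfolding B.near_codes_def q_def V_def using j(3) w(2) by (intro imageI) (simp add: mult.assoc)
      ultimately have "(prefix_code a (p n j) w, prefix_code b (q n j) w') \<in> I n j" by (simp add: I_def)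
      moreover have "z \<in> cell n j (prefix_code a (p n j) w, prefix_code b (q n j) w')"
        unfolding z cell_def using A.digit_sum_cell[OF w(1), of "p n j"] B.digit_sum_cell[OF w(2), of "q n j"] by auto
      ultimately show ?thesis unfolding \<U>_def using j(1) by blast
    qed
    then have "{n. dist_int (real a ^ n * digit_sum a w - xo) * dist_int (real b ^ n * digit_sum b w' - yo)
                         < exp (- real n * t)} \<subseteq> {n. z \<in> \<Union>(\<U> n)}" by blast
    then show ?thesis using inf finite_subset by blast
  qed
  show ?thesis
  proof (rule hausdorff_measure_limsup_eq_0[OF _ _ _ _ sum_le summ cov])
    show "finite (\<U> n)" for n using finI by (auto simp: \<U>_def)
    show "bounded S" if "S \<in> \<U> n" for n S using that bdd by (auto simp: \<U>_def)
    show "diameter S \<le> 2 * exp (- 1) ^ n" if S: "S \<in> \<U> n" for n S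
    proof -
      obtain j i where "S = cell n j i" using S by (auto simp: \<U>_def)
      then have "diameter S \<le> 2 * exp (- (real n * R j))" using diam by simp
      \<comment> \<open>\<open>R j \<ge> 1\<close> makes the diameters tend to 0 uniformly in
        \<open>j\<close>.\<close>
      also have "\<dots> \<le> 2 * exp (real n * (- 1))" using R1[of j] by (simp add: mult_le_cancel_left1)
      also have "\<dots> = 2 * exp (- 1) ^ n" by (simp only: exp_of_nat_mult)
      finally show ?thesis .
    qed
    have "(\<lambda>n. 2 * exp (- 1 :: real) ^ n) \<longlonglongrightarrow> 2 * 0"
      by (intro tendsto_mult tendsto_const LIMSEQ_power_zero) simp
    then show "(\<lambda>n. 2 * exp (- 1 :: real) ^ n) \<longlonglongrightarrow> 0" by simp
  qed
qed

text \<open>The grid loses \<open>t / J\<close> in the first exponent, hence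
  \<open>\<delta>\<^sub>1 * (t / J)\<close> on the right-hand side; the strict gap between
  \<open>s\<close> and the bound pays for this once \<open>J\<close> is large.\<close>

lemma hausdorff_measure_Mc_eq_0:
  assumes key: "\<And>U V. \<lbrakk>U \<ge> 0; V \<ge> 0; U + V = t\<rbrakk> \<Longrightarrow> \<theta> * max (La + U) (Lb + V) \<le> \<delta>\<^sub>1 * U + \<delta>\<^sub>2 * V"
    and s: "s \<ge> 0" "s > \<delta>\<^sub>1 + \<delta>\<^sub>2 - \<theta>"
  shows "hausdorff_measure s M = 0"
proof -
  note pos = A.sim_dim_pos B.sim_dim_pos A.ln_base_ge_1 B.ln_base_ge_1
  define \<theta>' where "\<theta>' = \<delta>\<^sub>1 + \<delta>\<^sub>2 - s"
  have \<theta>': "\<theta>' < \<theta>" using s by (simp add: \<theta>'_def)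
  \<comment> \<open>The maximum is at least \<open>La\<close>, so \<open>\<eta>\<close> is a lower
    bound for what the gap \<open>\<theta> - \<theta>'\<close> gains.\<close>
  define \<eta> where "\<eta> = (\<theta> - \<theta>') * La"
  have \<eta>: "\<eta> > 0" using \<theta>' pos by (simp add: \<eta>_def)
  obtain J0 :: nat where J0: "real J0 > \<delta>\<^sub>1 * t / \<eta>" using reals_Archimedean2 by blast
  \<comment> \<open>\<open>J \<ge> 2\<close> gives \<open>t / J < t\<close>, so that
    \<open>U\<close> and \<open>V\<close> below are not both 0.\<close>
  define J where "J = max J0 2"
  have J2: "J \<ge> 2" and "real J > \<delta>\<^sub>1 * t / \<eta>" using J0 by (auto simp: J_def)
  then have J: "\<delta>\<^sub>1 * (t / J) < \<eta>" using \<eta> by (simp add: field_simps)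
  show ?thesis
  proof (rule hausdorff_measure_Mc_eq_0_discrete[of s J])
    show "J \<ge> 1" using J2 by simp
    fix j assume j: "j < J"
    define U where "U = t * (real j / J)"
    define V where "V = t * ((real J - 1 - real j) / J)"
    have "real j + 1 \<le> real J" using j by linarith
    then have UV: "U \<ge> 0" "V \<ge> 0" using t by (auto simp: U_def V_def)
    have tJ: "t / J > 0" "t / J < t" using t J2 by (auto simp: divide_less_eq)
    \<comment> \<open>The discretised exponents add up to \<open>t - t / J\<close> only, so \<open>key\<close> is applied to \<open>U + t / J\<close> and \<open>V\<close>.\<close>
    have sum: "(U + t / J) + V = t" using J2 by (simp add: U_def V_def field_simps)
    have "\<theta>' * max (La + U) (Lb + V) < \<delta>\<^sub>1 * U + \<delta>\<^sub>2 * V"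
    proof (cases "\<theta>' \<le> 0")
      case True
      have mx: "max (La + U) (Lb + V) \<ge> 0" using UV pos by simp
      have "\<theta>' * max (La + U) (Lb + V) \<le> 0" using True mx by (rule mult_nonpos_nonneg)
      moreover have "\<delta>\<^sub>1 * U + \<delta>\<^sub>2 * V > 0"
      proof (cases "U > 0")
        case True then show ?thesis using pos UV by (intro add_pos_nonneg) auto
      next
        case False
        then have "V > 0" using sum tJ UV by linarith
        then show ?thesis using pos UV by (intro add_nonneg_pos) auto
      qed
      ultimately show ?thesis by linarith
    next
      case False
      let ?m = "max (La + (U + t / J)) (Lb + V)"
      have "\<theta>' * max (La + U) (Lb + V) \<le> \<theta>' * ?m" using False tJ by (intro mult_left_mono) auto
      also have "\<dots> = \<theta> * ?m - (\<theta> - \<theta>') * ?m" by (simp add: algebra_simps)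
      also have "(\<theta> - \<theta>') * ?m \<ge> \<eta>" unfolding \<eta>_def using \<theta>' UV tJ by (intro mult_left_mono) auto
      then have "\<theta> * ?m - (\<theta> - \<theta>') * ?m \<le> \<theta> * ?m - \<eta>" by simp
      also have "\<theta> * ?m \<le> \<delta>\<^sub>1 * (U + t / J) + \<delta>\<^sub>2 * V" using UV tJ sum by (intro key) auto
      finally have "\<theta>' * max (La + U) (Lb + V) \<le> \<delta>\<^sub>1 * (U + t / J) + \<delta>\<^sub>2 * V - \<eta>" by simp
      also have "\<dots> = \<delta>\<^sub>1 * U + \<delta>\<^sub>2 * V + (\<delta>\<^sub>1 * (t / J) - \<eta>)" by (simp add: algebra_simps)
      finally show ?thesis using J by linarith
    qed
    then show "(\<delta>\<^sub>1 + \<delta>\<^sub>2 - s) * max (La + t * (real j / J)) (Lb + t * ((real J - 1 - real j) / J))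
      < \<delta>\<^sub>1 * (t * (real j / J)) + \<delta>\<^sub>2 * (t * ((real J - 1 - real j) / J))"
      unfolding U_def V_def \<theta>'_def .
  qed (use s in auto)
qed

lemma hausdorff_dim_Mc_le:
  assumes key: "\<And>U V. \<lbrakk>U \<ge> 0; V \<ge> 0; U + V = t\<rbrakk> \<Longrightarrow> \<theta> * max (La + U) (Lb + V) \<le> \<delta>\<^sub>1 * U + \<delta>\<^sub>2 * V"
    and "\<delta>\<^sub>1 + \<delta>\<^sub>2 - \<theta> \<ge> 0"
  shows "hausdorff_dim M \<le> \<delta>\<^sub>1 + \<delta>\<^sub>2 - \<theta>"
proof (rule dense_ge)
  fix s assume "s > \<delta>\<^sub>1 + \<delta>\<^sub>2 - \<theta>"
  then show "hausdorff_dim M \<le> s"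
    using assms(2) by (intro hausdorff_dim_le hausdorff_measure_Mc_eq_0[OF key]) auto
qed

lemma hausdorff_dim_Mc_ge:
  assumes UV: "U \<ge> 0" "V \<ge> 0" "U + V = t"
    and \<theta>: "\<And>r. r \<ge> 0 \<Longrightarrow> \<delta>\<^sub>1 * min U (max 0 (r - La)) + \<delta>\<^sub>2 * min V (max 0 (r - Lb)) \<le> \<theta> * r"
  shows "hausdorff_dim M \<ge> \<delta>\<^sub>1 + \<delta>\<^sub>2 - \<theta>"
proof (rule hausdorff_dim_ge)
  \<comment> \<open>The witness of measure zero: for \<open>\<theta> = 0\<close> the exponent
    inequality is trivial.\<close>
  show "hausdorff_measure (\<delta>\<^sub>1 + \<delta>\<^sub>2 + 1) M = 0"
    using A.sim_dim_pos B.sim_dim_pos by (intro hausdorff_measure_Mc_eq_0[where \<theta> = 0]) auto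
  show "0 \<le> \<delta>\<^sub>1 + \<delta>\<^sub>2 + 1" using A.sim_dim_pos B.sim_dim_pos by simp
  show "hausdorff_measure s M \<noteq> 0" if "0 \<le> s" "s < \<delta>\<^sub>1 + \<delta>\<^sub>2 - \<theta>" for s
    using hausdorff_measure_Mc_nonzero[OF UV \<theta> that] by blast
qed

end

section \<open>Comparison of exponents\<close>

text \<open>Where \<open>Lb + V\<close> dominates, the first bound on \<open>\<theta>\<close> and
  \<open>d2 \<le> d1\<close> suffice. Where \<open>La + U\<close> dominates, both sides are affine
  in \<open>U\<close> and the endpoints decide: \<open>U = t\<close>, and either the point where the
  two expressions cross or, if they do not cross, \<open>U = 0\<close>.\<close>

lemma exponent_upper_inequality:
  fixes La Lb t d1 d2 \<theta> U V :: real
  assumes pos: "La > 0" "Lb > 0" "t > 0" "d2 > 0" "d2 \<le> d1"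
    and cases: "La \<le> t + Lb \<or> d1 * La \<le> d2 * (t + La)"
    and \<theta>: "\<theta> \<le> d2 * t / (t + Lb)" "\<theta> \<le> d1 * t / (t + La)"
    and UV: "U \<ge> 0" "V \<ge> 0" "U + V = t"
  shows "\<theta> * max (La + U) (Lb + V) \<le> d1 * U + d2 * V"
proof (cases "\<theta> \<le> 0")
  case True
  have "\<theta> * max (La + U) (Lb + V) \<le> 0" using True pos UV by (intro mult_nonpos_nonneg) auto
  moreover have "0 \<le> d1 * U + d2 * V" using pos UV by simp
  ultimately show ?thesis by linarith
next
  case False
  have 1: "\<theta> * (t + Lb) \<le> d2 * t" using \<theta>(1) pos by (simp add: field_simps)
  have 2: "\<theta> * (t + La) \<le> d1 * t" using \<theta>(2) pos by (simp add: field_simps)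
  have y: "\<theta> * (Lb + (t - u)) \<le> d1 * u + d2 * (t - u)" if "u \<ge> 0" for u
  proof -
    have "\<theta> * (Lb + (t - u)) \<le> \<theta> * (t + Lb)" using False that by (intro mult_left_mono) auto
    also have "\<dots> \<le> d2 * t" by (rule 1)
    also have "\<dots> \<le> d1 * u + d2 * (t - u)"
      using mult_right_mono[OF pos(5) that] by (simp add: algebra_simps)
    finally show ?thesis .
  qed
  have V: "V = t - U" using UV by simp
  have "\<theta> * (La + U) \<le> d1 * U + d2 * V" if big: "La + U \<ge> Lb + V"
  proof (cases "La \<le> t + Lb")
    case True
    \<comment> \<open>At \<open>u\<close> both entries of the maximum agree, so the inequality there
      is inherited from \<open>y\<close>.\<close>
    define u where "u = (Lb + t - La) / 2"
    have u: "0 \<le> u" "u \<le> U" using True big UV by (auto simp: u_def)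
    have eq: "La + u = Lb + (t - u)" by (simp add: u_def field_simps)
    have at_u: "\<theta> * (La + u) \<le> d1 * u + d2 * (t - u)" unfolding eq by (rule y[OF u(1)])
    show ?thesis
    \<comment> \<open>The sign of the slope in \<open>U\<close> decides whether \<open>u\<close> or
      \<open>t\<close> is the endpoint to compare with.\<close>
    proof (cases "d1 - d2 - \<theta> \<ge> 0")
      case True
      then have "(d1 - d2 - \<theta>) * u \<le> (d1 - d2 - \<theta>) * U" using u by (intro mult_left_mono)
      then show ?thesis using at_u unfolding V by (simp add: algebra_simps)
    next
      case False
      then have "(d1 - d2 - \<theta>) * t \<le> (d1 - d2 - \<theta>) * U" using UV by (intro mult_left_mono_neg) auto
      then show ?thesis using 2 unfolding V by (simp add: algebra_simps)
    qed
  next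
    case False
    then have c: "d1 * La \<le> d2 * (t + La)" using cases by blast
    \<comment> \<open>The aim is the endpoint \<open>U = 0\<close>, that is
      \<open>\<theta> * La \<le> d2 * t\<close>; it is then averaged with the endpoint
      \<open>U = t\<close>, with weights \<open>V\<close> and \<open>U\<close>.\<close>
    have "\<theta> * (t + La) * La \<le> d1 * t * La" using 2 pos by (intro mult_right_mono) auto
    also have "\<dots> \<le> d2 * (t + La) * t" using mult_right_mono[OF c, of t] pos by (simp add: mult_ac)
    finally have "(t + La) * (\<theta> * La) \<le> (t + La) * (d2 * t)" by (simp only: mult_ac)
    then have "\<theta> * La \<le> d2 * t" using pos by (subst (asm) mult_le_cancel_left_pos) auto
    then have "V * (\<theta> * La) \<le> V * (d2 * t)" using UV by (intro mult_left_mono)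
    moreover have "U * (\<theta> * (t + La)) \<le> U * (d1 * t)" using 2 UV by (intro mult_left_mono)
    ultimately have "U * (\<theta> * (t + La)) + V * (\<theta> * La) \<le> U * (d1 * t) + V * (d2 * t)" by linarith
    moreover have "U * (\<theta> * (t + La)) + V * (\<theta> * La) = t * (\<theta> * (La + U))"
      unfolding V by (simp add: algebra_simps)
    moreover have "U * (d1 * t) + V * (d2 * t) = t * (d1 * U + d2 * V)" by (simp add: algebra_simps)
    ultimately show ?thesis using pos by simp
  qed
  then show ?thesis using y[OF UV(1)] unfolding V by (auto simp: max_def)
qed

text \<open>The share of the scale lost to a window that opens at \<open>L\<close> with length
  \<open>V\<close> is largest where it closes, at \<open>r = L + V\<close>.\<close>

lemma window_ratio:
  fixes L V r :: real
  assumes "L > 0" "V \<ge> 0" "r \<ge> 0"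
  shows "min V (max 0 (r - L)) * (L + V) \<le> V * r"
proof (cases "r \<le> L")
  case True
  then show ?thesis using assms by (simp add: max_def min_def)
next
  case False
  show ?thesis
  proof (cases "r - L \<le> V")
    case True
    have "0 \<le> L * (V - (r - L))" using True assms by (intro mult_nonneg_nonneg) auto
    moreover have eq: "min V (max 0 (r - L)) = r - L" using True False by auto
    ultimately show ?thesis unfolding eq by (simp add: algebra_simps)
  next
    case F2: False
    have "V * (L + V) \<le> V * r" using F2 assms by (intro mult_left_mono) auto
    then show ?thesis using False F2 by (simp add: max_def min_def)
  qed
qed

text \<open>By \<open>sep\<close> the second window closes no later than the first opens, so the
  relative loss can peak only at \<open>r = Lb + V\<close> and \<open>r = La + U\<close>; the two
  hypotheses on \<open>\<theta>\<close> are the bounds at these scales.\<close>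

lemma two_windows_deficit:
  fixes La Lb d1 d2 \<theta> U V r :: real
  assumes pos: "Lb > 0" "U \<ge> 0" "V \<ge> 0" "d1 > 0" "d2 > 0" "\<theta> \<ge> 0" and sep: "Lb + V \<le> La"
    and \<theta>: "d2 * V \<le> \<theta> * (Lb + V)" "d1 * U + d2 * V \<le> \<theta> * (La + U)" and r: "r \<ge> 0"
  shows "d1 * min U (max 0 (r - La)) + d2 * min V (max 0 (r - Lb)) \<le> \<theta> * r"
proof (cases "r \<le> La")
  case True
  have "(Lb + V) * (d2 * min V (max 0 (r - Lb))) = d2 * (min V (max 0 (r - Lb)) * (Lb + V))" by simp
  also have "\<dots> \<le> d2 * (V * r)" using pos r by (intro mult_left_mono window_ratio) auto
  also have "\<dots> = (d2 * V) * r" by simp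
  also have "\<dots> \<le> (\<theta> * (Lb + V)) * r" using \<theta>(1) r by (intro mult_right_mono)
  finally have "(Lb + V) * (d2 * min V (max 0 (r - Lb))) \<le> (Lb + V) * (\<theta> * r)" by (simp only: mult_ac)
  then have "d2 * min V (max 0 (r - Lb)) \<le> \<theta> * r"
    using pos by (subst (asm) mult_le_cancel_left_pos) auto
  moreover have "min U (max 0 (r - La)) = 0" using True pos by simp
  ultimately show ?thesis by simp
next
  case False
  have "d2 * min V (max 0 (r - Lb)) \<le> d2 * V" using pos by (intro mult_left_mono) auto
  moreover have "d1 * min U (max 0 (r - La)) + d2 * V \<le> \<theta> * r"
  proof (cases "r \<ge> La + U")
    case True
    have "\<theta> * (La + U) \<le> \<theta> * r" using True pos by (intro mult_left_mono) auto
    moreover have "d1 * min U (max 0 (r - La)) \<le> d1 * U" using pos by (intro mult_left_mono) auto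
    ultimately show ?thesis using \<theta>(2) by linarith
  next
    case F2: False
    then have eq: "min U (max 0 (r - La)) = r - La" using False by (simp add: max_def min_def)
    have "\<theta> * (Lb + V) \<le> \<theta> * La" using sep pos by (intro mult_left_mono) auto
    then have at_La: "d2 * V \<le> \<theta> * La" using \<theta>(1) by linarith
    show ?thesis
    \<comment> \<open>Between \<open>La\<close> and \<open>La + U\<close> the comparison is affine
      in \<open>r\<close> with slope \<open>\<theta> - d1\<close>, whose sign selects the
      endpoint.\<close>
    proof (cases "\<theta> \<ge> d1")
      case True
      then have "(\<theta> - d1) * La \<le> (\<theta> - d1) * r" using False by (intro mult_left_mono) auto
      then show ?thesis using at_La unfolding eq by (simp add: algebra_simps)
    next
      case F3: False
      then have "(\<theta> - d1) * (La + U) \<le> (\<theta> - d1) * r" using F2 by (intro mult_left_mono_neg) auto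
      then show ?thesis using \<theta>(2) unfolding eq by (simp add: algebra_simps)
    qed
  qed
  ultimately show ?thesis by linarith
qed

text \<open>\<open>d2 * t / (t + Lb)\<close> and \<open>d1 * t / (t + La)\<close> are the peak
  losses for U = 0 and for V = 0. The peak at \<open>Lb + V\<close> falls below the former once V <
  t, the peak at \<open>La + U\<close> below the latter, by \<open>neg\<close>, once V > 0. It
  remains to push the other peak below the smaller value: near U = 0, where \<open>gap\<close>
  leaves room, or near V = 0, where the peak at \<open>Lb + V\<close> tends to 0.\<close>

lemma interior_exponents_exist:
  fixes La Lb t d1 d2 :: real
  assumes pos: "Lb > 0" "t > 0" "d1 > 0" "d2 > 0"
    and gap: "La > t + Lb" and neg: "d2 * (t + La) < d1 * La"
  obtains U V \<theta> where "U \<ge> 0" "V \<ge> 0" "U + V = t" "\<theta> \<ge> 0" "d2 * V \<le> \<theta> * (Lb + V)"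
    "d1 * U + d2 * V \<le> \<theta> * (La + U)" "\<theta> < d2 * t / (t + Lb)" "\<theta> < d1 * t / (t + La)"
proof -
  define T1 where "T1 = d2 * t / (t + Lb)"
  define T2 where "T2 = d1 * t / (t + La)"
  have La: "La > 0" using gap pos by simp
  have T: "T1 > 0" "T2 > 0" using pos La by (auto simp: T1_def T2_def)
  have T1e: "T1 * (t + Lb) = d2 * t" using pos by (simp add: T1_def)
  have T2e: "T2 * (t + La) = d1 * t" using pos La by (simp add: T2_def)
  have h1: "d2 * V / (Lb + V) < T1" if "V < t" "V \<ge> 0" for V
    using that pos by (simp add: T1_def divide_simps algebra_simps)
  have h2: "(d1 * U + d2 * V) / (La + U) < T2" if "V > 0" "U \<ge> 0" "U + V = t" for U V
  proof -
    have "0 < V * (d1 * La - d2 * (t + La))" using that neg by simp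
    also have "V * (d1 * La - d2 * (t + La)) = d1 * t * (La + U) - (d1 * U + d2 * V) * (t + La)"
      unfolding that(3)[symmetric] by (simp add: algebra_simps)
    finally have "(d1 * U + d2 * V) * (t + La) < d1 * t * (La + U)" by simp
    then show ?thesis using La that pos unfolding T2_def by (simp add: divide_less_eq less_divide_eq)
  qed
  have "\<exists>U V. U > 0 \<and> V > 0 \<and> U + V = t \<and> d2 * V / (Lb + V) < min T1 T2 \<and> (d1 * U + d2 * V) / (La + U) < min T1 T2"
  proof (cases "T1 \<le> T2")
    case True
    \<comment> \<open>\<open>X\<close> is the slack that \<open>gap\<close> leaves at
      \<open>U = 0\<close>; \<open>U\<close> is chosen so that \<open>d1 * U\<close> uses at most
      half of it.\<close>
    define X where "X = T1 * La - d2 * t"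
    have g: "X > 0" using T1e mult_strict_left_mono[OF gap T(1)] by (simp add: X_def)
    define U where "U = min (t / 2) (X / (2 * d1))"
    have U: "U > 0" "U < t" using g pos by (auto simp: U_def)
    have "d1 * U \<le> d1 * (X / (2 * d1))" using pos by (intro mult_left_mono) (auto simp: U_def)
    also have "\<dots> = X / 2" using pos by simp
    finally have "d1 * U < T1 * La - d2 * t" unfolding X_def[symmetric] using g by linarith
    moreover have "d2 * (t - U) \<le> d2 * t" using pos U by simp
    moreover have "0 < T1 * U" using T U by simp
    ultimately have "d1 * U + d2 * (t - U) < T1 * (La + U)" unfolding distrib_left by linarith
    then have "(d1 * U + d2 * (t - U)) / (La + U) < T1" using La U by (simp add: divide_less_eq)
    then show ?thesis using True U h1[of "t - U"] by (intro exI[of _ U] exI[of _ "t - U"]) auto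
  next
    case False
    \<comment> \<open>The second entry keeps \<open>d2 * V\<close> at most half of
      \<open>T2 * Lb\<close>.\<close>
    define V where "V = min (t / 2) (T2 * Lb / (2 * d2))"
    have V: "V > 0" "V < t" using T pos by (auto simp: V_def)
    have "d2 * V \<le> d2 * (T2 * Lb / (2 * d2))" using pos by (intro mult_left_mono) (auto simp: V_def)
    also have "\<dots> = T2 * Lb / 2" using pos by simp
    also have "\<dots> < T2 * (Lb + V)" using T V pos by (simp add: algebra_simps add_pos_pos)
    finally have "d2 * V / (Lb + V) < T2" using V pos by (simp add: divide_less_eq)
    then show ?thesis using False V h2[of V "t - V"] by (intro exI[of _ "t - V"] exI[of _ V]) auto
  qed
  then obtain U V where UV: "U > 0" "V > 0" "U + V = t"
    "d2 * V / (Lb + V) < min T1 T2" "(d1 * U + d2 * V) / (La + U) < min T1 T2" by blast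
  define \<theta> where "\<theta> = max (d2 * V / (Lb + V)) ((d1 * U + d2 * V) / (La + U))"
  have le: "d2 * V / (Lb + V) \<le> \<theta>" "(d1 * U + d2 * V) / (La + U) \<le> \<theta>" by (auto simp: \<theta>_def)
  have "0 \<le> d2 * V / (Lb + V)" using pos UV by simp
  then have "\<theta> \<ge> 0" using le(1) by linarith
  moreover have "d2 * V \<le> \<theta> * (Lb + V)" "d1 * U + d2 * V \<le> \<theta> * (La + U)"
    using le pos La UV(1,2) by (simp_all add: pos_divide_le_eq)
  moreover have "\<theta> < T1" "\<theta> < T2" using UV(4,5) by (simp_all add: \<theta>_def)
  ultimately show thesis
    using UV(1-3) unfolding T1_def T2_def by (intro that[of U V \<theta>]) auto
qed

context product_digits
begin

lemma hausdorff_dim_Mc_ge_max: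
  "hausdorff_dim M \<ge> \<delta>\<^sub>1 + \<delta>\<^sub>2 - \<delta>\<^sub>2 * t / (t + Lb)" "hausdorff_dim M \<ge> \<delta>\<^sub>1 + \<delta>\<^sub>2 - \<delta>\<^sub>1 * t / (t + La)"
proof -
  note pos = A.sim_dim_pos B.sim_dim_pos A.ln_base_ge_1 B.ln_base_ge_1
  have single: "d * min t (max 0 (r - L)) \<le> d * t / (t + L) * r" if "d > 0" "L > 0" "r \<ge> 0" for d L r
  proof -
    have "d * (min t (max 0 (r - L)) * (L + t)) \<le> d * (t * r)"
      using that t by (intro mult_left_mono window_ratio) auto
    then show ?thesis using that t by (simp add: field_simps)
  qed
  show "hausdorff_dim M \<ge> \<delta>\<^sub>1 + \<delta>\<^sub>2 - \<delta>\<^sub>2 * t / (t + Lb)"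
    by (intro hausdorff_dim_Mc_ge[of 0 t]) (use t pos single[of \<delta>\<^sub>2 Lb] in simp_all)
  show "hausdorff_dim M \<ge> \<delta>\<^sub>1 + \<delta>\<^sub>2 - \<delta>\<^sub>1 * t / (t + La)"
    by (intro hausdorff_dim_Mc_ge[of t 0]) (use t pos single[of \<delta>\<^sub>1 La] in simp_all)
qed

end

theorem mainTheorem13:
  fixes a b :: nat and \<Lambda>a \<Lambda>b :: "nat set" and xo yo t :: real
  assumes "a \<ge> 3" "b \<ge> 3"
    and "\<Lambda>a \<subseteq> {0..<a}" "\<Lambda>b \<subseteq> {0..<b}"
    and "card \<Lambda>a \<ge> 2" "card \<Lambda>b \<ge> 2"
    and "xo \<in> attractor a \<Lambda>a" "yo \<in> attractor b \<Lambda>b"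
    and "ln (card \<Lambda>a) / ln a \<ge> ln (card \<Lambda>b) / ln b"
    and "t > 0"
  shows "let \<delta>1 = ln (card \<Lambda>a) / ln a; \<delta>2 = ln (card \<Lambda>b) / ln b;
             F = max (\<delta>1 + \<delta>2 * ln b / (t + ln b)) (\<delta>2 + \<delta>1 * ln a / (t + ln a));
             D = hausdorff_dim (Mc a \<Lambda>a b \<Lambda>b xo yo t)
         in ((a \<le> b
              \<or> (a > b \<and> ln a \<le> t + ln b)
              \<or> (a > b \<and> ln a > t + ln b \<and> \<delta>2 * (t + ln a) \<ge> \<delta>1 * ln a)) \<longrightarrow> D = F)
          \<and> ((a > b \<and> ln a > t + ln b \<and> \<delta>2 * (t + ln a) < \<delta>1 * ln a) \<longrightarrow> D \<noteq> F)"
proof -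
  interpret A: restricted_digits a \<Lambda>a using assms by unfold_locales auto
  interpret B: restricted_digits b \<Lambda>b using assms by unfold_locales auto
  interpret product_digits a \<Lambda>a b \<Lambda>b xo yo t using assms by unfold_locales auto
  note pos = A.sim_dim_pos B.sim_dim_pos A.ln_base_ge_1 B.ln_base_ge_1 \<open>t > 0\<close>
  have le: "\<delta>\<^sub>2 \<le> \<delta>\<^sub>1" using assms(9) by (simp add: A.sim_dim_def B.sim_dim_def)
  define F where "F = max (\<delta>\<^sub>1 + \<delta>\<^sub>2 * Lb / (t + Lb)) (\<delta>\<^sub>2 + \<delta>\<^sub>1 * La / (t + La))"
  define \<theta> where "\<theta> = min (\<delta>\<^sub>2 * t / (t + Lb)) (\<delta>\<^sub>1 * t / (t + La))"
  \<comment> \<open>Each term is rewritten as the full dimension minus a loss, so the maximum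
    becomes a minimum of losses.\<close>
  have "\<delta>\<^sub>1 + \<delta>\<^sub>2 * Lb / (t + Lb) = \<delta>\<^sub>1 + \<delta>\<^sub>2 - \<delta>\<^sub>2 * t / (t + Lb)"
    "\<delta>\<^sub>2 + \<delta>\<^sub>1 * La / (t + La) = \<delta>\<^sub>1 + \<delta>\<^sub>2 - \<delta>\<^sub>1 * t / (t + La)"
    using pos by (auto simp: divide_simps add_pos_pos) (auto simp: algebra_simps)
  then have F: "F = \<delta>\<^sub>1 + \<delta>\<^sub>2 - \<theta>" unfolding F_def \<theta>_def by (simp add: min_def max_def)
  have F0: "F \<ge> 0" unfolding F_def using pos by (intro max.coboundedI1) auto
  have ge: "hausdorff_dim M \<ge> F"
    using hausdorff_dim_Mc_ge_max by (simp add: F \<theta>_def min_def)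
  \<comment> \<open>All three positive cases imply this disjunction; for \<open>a \<le> b\<close>
    the first alternative holds because \<open>La \<le> Lb\<close>.\<close>
  have eq: "hausdorff_dim M = F" if "La \<le> t + Lb \<or> \<delta>\<^sub>1 * La \<le> \<delta>\<^sub>2 * (t + La)"
  proof (rule antisym[OF _ ge])
    have "hausdorff_dim M \<le> \<delta>\<^sub>1 + \<delta>\<^sub>2 - \<theta>"
    proof (rule hausdorff_dim_Mc_le)
      show "\<theta> * max (La + U) (Lb + V) \<le> \<delta>\<^sub>1 * U + \<delta>\<^sub>2 * V" if "U \<ge> 0" "V \<ge> 0" "U + V = t" for U V
        using that \<open>La \<le> t + Lb \<or> \<delta>\<^sub>1 * La \<le> \<delta>\<^sub>2 * (t + La)\<close> pos le
        by (intro exponent_upper_inequality[of La Lb t]) (auto simp: \<theta>_def)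
      show "0 \<le> \<delta>\<^sub>1 + \<delta>\<^sub>2 - \<theta>" using F0 F by simp
    qed
    then show "hausdorff_dim M \<le> F" using F by simp
  qed
  \<comment> \<open>The formula fails here because the dimension is strictly larger: an interior
    split loses less than either extreme.\<close>
  have neq: "hausdorff_dim M \<noteq> F" if gap: "La > t + Lb" "\<delta>\<^sub>2 * (t + La) < \<delta>\<^sub>1 * La"
  proof -
    have "Lb > 0" using pos by simp
    from interior_exponents_exist[OF this \<open>t > 0\<close> pos(1,2) gap] obtain U V \<theta>' where
      U: "U \<ge> 0" and V: "V \<ge> 0" and UV: "U + V = t" and \<theta>'0: "\<theta>' \<ge> 0"
      and \<theta>': "\<delta>\<^sub>2 * V \<le> \<theta>' * (Lb + V)" "\<delta>\<^sub>1 * U + \<delta>\<^sub>2 * V \<le> \<theta>' * (La + U)"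
      and less: "\<theta>' < \<delta>\<^sub>2 * t / (t + Lb)" "\<theta>' < \<delta>\<^sub>1 * t / (t + La)" by blast
    have "hausdorff_dim M \<ge> \<delta>\<^sub>1 + \<delta>\<^sub>2 - \<theta>'"
      using pos U V UV \<theta>'0 \<theta>' gap
      by (intro hausdorff_dim_Mc_ge[OF U V UV] two_windows_deficit) auto
    moreover have "\<theta>' < \<theta>" using less by (simp add: \<theta>_def)
    ultimately show ?thesis using F by linarith
  qed
  have "La \<le> t + Lb" if "a \<le> b"
  proof -
    have "La \<le> Lb" using that assms(1) by simp
    then show ?thesis using \<open>t > 0\<close> by simp
  qed
  then show ?thesis
    using eq neq unfolding Let_def F_def A.sim_dim_def[symmetric] B.sim_dim_def[symmetric] by blast
qed

end
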